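(* Let $G$ be an $r$-hourglass plabic graph without isolated components and let $F$ be a square face of $G$. Then $F$ is fully reduced if and only if $m(F)\le r$.
   Context: $r$-hourglass plabic graph: bipartite planar graph $\widehat G$ in a disk with a fixed black–white coloring and positive integer edge multiplicities (an edge of multiplicity $m$, an $m$-hourglass, drawn as $m$ strands twisted so the clockwise order of strands agrees at both ends), every internal vertex of degree $r$ counted with multiplicity, boundary vertices of simple degree one labeled $b_1,\dots,b_n$ clockwise. An isolated component is a connected component containing no boundary vertex. A face is a region of the disk cut out by $\widehat G$ not adjacent to the boundary circle; it is a square if bounded by a cycle of 4 edges $e_1,\dots,e_4$; $m(F)=\sum m(e_i)$. Sub-hourglass plabic graph: for a Jordan curve $C$ in the disk avoiding vertices and meeting each edge at most once transversally, $G|_C$ consists of the vertices and edges of $G$ inside $C$ (same colors and multiplicities), and for each $m$-hourglass $e$ crossing $C$ with inner endpoint $v$ and outer endpoint $w$, $m$ consecutive simple edges from $v$ to $m$ new consecutive boundary vertices on $C$ colored like $w$; these are the only boundary vertices. $\widetilde F=G|_C$ where $C$ encloses exactly the vertices and edges of $F$ and crosses all other edges at the vertices of $F$. $F$ is fully reduced if $\widetilde F$ is. Trip segments: for $1\le i\le r-1$, walks along strands taking the $i$-th leftmost turn at white vertices and the $i$-th rightmost turn at black vertices (from a boundary vertex or from the interior); those looping inside one hourglass are trivial and ignored. Fully reduced: no isolated component; no trip segment visits a vertex more than once; and (intersections of two distinct segments defined by drawing them on $\widehat G$ and contracting commonly traversed edges, essential if they cross, inessential if they bounce; segments sharing a boundary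 endpoint $b_k$ intersect essentially at the internal neighbor of $b_k$) no two $\mathrm{trip}_i$-segments and no $\mathrm{trip}_i$- and $\mathrm{trip}_{i+1}$-segment have an oriented double crossing (an essential intersection followed forward along both by another). *)

theory Defs
  imports "Graph_Theory.Graph_Theory" "HOL-Combinatorics.Orbits"
begin

text \<open>
  The graph underlying an hourglass graph, embedded in a disk, is encoded as a combinatorial map:
  every edge is a pair of mutually opposite arcs (\<open>opp\<close>), and \<open>rot\<close> sends an arc to the
  next arc, in clockwise order, leaving the same vertex. Parallel edges are allowed. An edge of
  multiplicity m is an m-hourglass. The list \<open>bdry\<close> holds the boundary vertices
  \<open>b\<^sub>1, \<dots>, b\<^sub>n\<close>, clockwise on the circle.
\<close>

record ('v, 'a) hourglass_graph =
  base  :: "('v, 'a) pre_digraph"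
  opp   :: "'a \<Rightarrow> 'a"
  rot   :: "'a \<Rightarrow> 'a"
  mult  :: "'a \<Rightarrow> nat"
  white :: "'v \<Rightarrow> bool"
  bdry  :: "'v list"

abbreviation darts :: "('v, 'a) hourglass_graph \<Rightarrow> 'a set" where
  "darts G \<equiv> arcs (base G)"

abbreviation src :: "('v, 'a) hourglass_graph \<Rightarrow> 'a \<Rightarrow> 'v" where
  "src G \<equiv> tail (base G)"

abbreviation tgt :: "('v, 'a) hourglass_graph \<Rightarrow> 'a \<Rightarrow> 'v" where
  "tgt G \<equiv> head (base G)"


subsection \<open>Planarity in the disk\<close>

text \<open>
  Collapsing the boundary circle to a point turns the disk into a sphere and the boundary vertices
  into one vertex. The clockwise order of the boundary edges around that vertex, seen from the same
  side of the surface, is the counterclockwise order of the labels. An embedding in the disk is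
  thus a combinatorial map which, after merging the boundary vertices in this way, has genus 0 in
  each connected component. Boundary vertices have exactly one outgoing arc.
\<close>

definition disk_rot :: "('v, 'a) hourglass_graph \<Rightarrow> 'a \<Rightarrow> 'a" where
  "disk_rot G a =
     (if a \<in> darts G \<and> src G a \<in> set (bdry G)
      then let n = length (bdry G);
               j = (THE j. j < n \<and> bdry G ! j = src G a)
           in (THE d. d \<in> out_arcs (base G) (bdry G ! ((j + n - 1) mod n)))
      else rot G a)"

definition map_component :: "('v, 'a) hourglass_graph \<Rightarrow> 'a \<Rightarrow> 'a set" where
  "map_component G a = {(d, d'). d \<in> darts G \<and> (d' = opp G d \<or> d' = disk_rot G d)}\<^sup>* `` {a}"

text \<open>
  Euler's formula \<open>V - E + F = 2 * C\<close>, summed over all components, in the form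
  \<open>V + E + F = 2 * E + 2 * C\<close>; V, E, F are the numbers of cycles of the three permutations
  and \<open>2 * E\<close> is the number of arcs. Vertices without edges impose no condition.
\<close>

definition planar_in_disk :: "('v, 'a) hourglass_graph \<Rightarrow> bool" where
  "planar_in_disk G \<longleftrightarrow>
     card (orbit (disk_rot G) ` darts G) + card (orbit (opp G) ` darts G)
       + card (orbit (\<lambda>a. disk_rot G (opp G a)) ` darts G)
     = card (darts G) + 2 * card (map_component G ` darts G)"


subsection \<open>Hourglass plabic graphs\<close>

locale hourglass_plabic_graph =
  fin_digraph "base G" + bidirected_digraph "base G" "opp G"
  for r :: nat and G :: "('v, 'a) hourglass_graph" +
  assumes rot_permutes: "rot G permutes darts G"
    and rot_cyclic:
      "\<And>v. v \<in> verts (base G) \<Longrightarrow> out_arcs (base G) v \<noteq> {}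
         \<Longrightarrow> cyclic_on (rot G) (out_arcs (base G) v)"
    and mult_pos: "\<And>a. a \<in> darts G \<Longrightarrow> 0 < mult G a"
    and mult_opp: "\<And>a. a \<in> darts G \<Longrightarrow> mult G (opp G a) = mult G a"
    and bipartite: "\<And>a. a \<in> darts G \<Longrightarrow> white G (src G a) \<noteq> white G (tgt G a)"
    and bdry_distinct: "distinct (bdry G)"
    and bdry_verts: "set (bdry G) \<subseteq> verts (base G)"
    and bdry_simple_degree: "\<And>b. b \<in> set (bdry G) \<Longrightarrow> card (out_arcs (base G) b) = 1"
    and internal_degree:
      "\<And>v. v \<in> verts (base G) \<Longrightarrow> v \<notin> set (bdry G)
         \<Longrightarrow> (\<Sum>a\<in>out_arcs (base G) v. mult G a) = r"
    and planar: "planar_in_disk G"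

text \<open>Since arcs come in opposite pairs, strongly connected components are connected components.\<close>

definition isolated_component :: "('v, 'a) hourglass_graph \<Rightarrow> 'v set \<Rightarrow> bool" where
  "isolated_component G C \<longleftrightarrow> C \<in> pre_digraph.sccs_verts (base G) \<and> C \<inter> set (bdry G) = {}"

definition no_isolated_components :: "('v, 'a) hourglass_graph \<Rightarrow> bool" where
  "no_isolated_components G \<longleftrightarrow> (\<nexists>C. isolated_component G C)"


subsection \<open>Faces\<close>

text \<open>
  A face is given by the arcs having it on their left. If there are no isolated components,
  every region that is not adjacent to the circle has a single boundary contour, and the regions
  adjacent to the circle are those whose contour passes through a boundary vertex.
\<close>

definition face :: "('v, 'a) hourglass_graph \<Rightarrow> 'a set \<Rightarrow> bool" where
  "face G F \<longleftrightarrow>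
     (\<exists>a\<in>darts G. F = orbit (\<lambda>d. rot G (opp G d)) a) \<and> (\<forall>d\<in>F. src G d \<notin> set (bdry G))"

definition square_face :: "('v, 'a) hourglass_graph \<Rightarrow> 'a set \<Rightarrow> bool" where
  "square_face G F \<longleftrightarrow>
     face G F \<and> (\<exists>p. pre_digraph.cycle (base G) p \<and> length p = 4 \<and> set p = F)"

definition face_mult :: "('v, 'a) hourglass_graph \<Rightarrow> 'a set \<Rightarrow> nat" where
  "face_mult G F = (\<Sum>a\<in>F. mult G a)"


subsection \<open>Trip segments\<close>

text \<open>
  The pair \<open>(a, k)\<close> with \<open>k < mult G a\<close> is the strand number k of the arc a, directed
  from the tail of a to its head; strands are numbered clockwise around the tail of a. By the twist
  of hourglasses this numbering is also clockwise around the head, so the reverse of \<open>(a, k)\<close>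
  is \<open>(opp G a, k)\<close>.
\<close>

type_synonym 'a strand = "'a \<times> nat"

fun cw_strand :: "('v, 'a) hourglass_graph \<Rightarrow> 'a strand \<Rightarrow> 'a strand" where
  "cw_strand G (a, k) = (if Suc k < mult G a then (a, Suc k) else (rot G a, 0))"

fun ccw_strand :: "('v, 'a) hourglass_graph \<Rightarrow> 'a strand \<Rightarrow> 'a strand" where
  "ccw_strand G (a, 0) = (inv (rot G) a, mult G (inv (rot G) a) - 1)"
| "ccw_strand G (a, Suc k) = (a, k)"

text \<open>
  A walker entering a vertex along a strand finds, to the left, the strands that follow the
  entering strand clockwise, the sharpest turn first.
\<close>

definition trip_step :: "('v, 'a) hourglass_graph \<Rightarrow> nat \<Rightarrow> 'a strand \<Rightarrow> 'a strand" where
  "trip_step G i = (\<lambda>(a, k).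
     if white G (tgt G a) then (cw_strand G ^^ i) (opp G a, k)
     else (ccw_strand G ^^ i) (opp G a, k))"

text \<open>A strand after which the walk turns back into the same hourglass. The walk then
  bounces between the two ends of that hourglass.\<close>

definition turns_back :: "('v, 'a) hourglass_graph \<Rightarrow> nat \<Rightarrow> 'a strand \<Rightarrow> bool" where
  "turns_back G i s \<longleftrightarrow>
     tgt G (fst s) \<notin> set (bdry G) \<and> fst (trip_step G i s) = opp G (fst s)"

text \<open>Nontrivial trip segments, starting anywhere and not necessarily maximal.\<close>

definition trip_segment :: "('v, 'a) hourglass_graph \<Rightarrow> nat \<Rightarrow> 'a strand list \<Rightarrow> bool" where
  "trip_segment G i P \<longleftrightarrow>
     P \<noteq> [] \<and>
     (\<forall>(a, k)\<in>set P. a \<in> darts G \<and> k < mult G a) \<and>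
     (\<forall>j. Suc j < length P \<longrightarrow>
        tgt G (fst (P ! j)) \<notin> set (bdry G) \<and> P ! Suc j = trip_step G i (P ! j)) \<and>
     (\<forall>s\<in>set P. \<not> turns_back G i s)"

definition visits :: "('v, 'a) hourglass_graph \<Rightarrow> 'a strand list \<Rightarrow> 'v list" where
  "visits G P = src G (fst (hd P)) # map (\<lambda>s. tgt G (fst s)) P"


subsection \<open>Intersections of trip segments\<close>

definition common_darts ::
    "('v, 'a) hourglass_graph \<Rightarrow> 'a strand list \<Rightarrow> 'a strand list \<Rightarrow> 'a set" where
  "common_darts G P Q =
     {a. (a \<in> fst ` set P \<or> opp G a \<in> fst ` set P) \<and> (a \<in> fst ` set Q \<or> opp G a \<in> fst ` set Q)}"

definition contracted_walk :: "'a set \<Rightarrow> 'a strand list \<Rightarrow> 'a list" where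
  "contracted_walk S P = filter (\<lambda>a. a \<notin> S) (map fst P)"

text \<open>
  Clockwise rotation after contracting the edges in S (a set closed under \<open>opp\<close>):
  iterating this map walks clockwise around the contracted edges, so that the arcs outside
  S occur in their clockwise order around the vertex resulting from the contraction. The arcs
  in S that are met as well mark corners and play no role.
\<close>

definition contracted_rot :: "('v, 'a) hourglass_graph \<Rightarrow> 'a set \<Rightarrow> 'a \<Rightarrow> 'a" where
  "contracted_rot G S a = rot G (if a \<in> S then opp G a else a)"

text \<open>The elements strictly between x and y in the cycle of \<open>\<pi>\<close> starting at x.\<close>

definition between :: "('a \<Rightarrow> 'a) \<Rightarrow> 'a \<Rightarrow> 'a \<Rightarrow> 'a set" where
  "between \<pi> x y = {(\<pi> ^^ j) x |j. 0 < j \<and> (\<forall>i. 0 < i \<and> i \<le> j \<longrightarrow> (\<pi> ^^ i) x \<noteq> x \<and> (\<pi> ^^ i) x \<noteq> y)}"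

text \<open>The pairs \<open>{x, y}\<close> and \<open>{z, u}\<close> separate each other in a cycle of \<open>\<pi>\<close>.\<close>

definition separates :: "('a \<Rightarrow> 'a) \<Rightarrow> 'a \<Rightarrow> 'a \<Rightarrow> 'a \<Rightarrow> 'a \<Rightarrow> bool" where
  "separates \<pi> x y z u \<longleftrightarrow> x \<noteq> y \<and>
     (z \<in> between \<pi> x y \<and> u \<in> between \<pi> y x \<or> u \<in> between \<pi> x y \<and> z \<in> between \<pi> y x)"

definition crosses_at ::
    "('v, 'a) hourglass_graph \<Rightarrow> 'a strand list \<Rightarrow> 'a strand list \<Rightarrow> nat \<Rightarrow> nat \<Rightarrow> bool" where
  "crosses_at G P Q k l \<longleftrightarrow>
     (let S = common_darts G P Q; p = contracted_walk S P; q = contracted_walk S Q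
      in 0 < k \<and> k < length p \<and> 0 < l \<and> l < length q \<and>
         separates (contracted_rot G S) (opp G (p ! (k - 1))) (p ! k) (opp G (q ! (l - 1))) (q ! l))"

text \<open>The vertex at position k of P, after contraction of the edges in S, contains the end b
  of P.\<close>

definition end_at ::
    "('v, 'a) hourglass_graph \<Rightarrow> 'a set \<Rightarrow> 'a strand list \<Rightarrow> nat \<Rightarrow> 'v \<Rightarrow> bool" where
  "end_at G S P k b \<longleftrightarrow>
     k = 0 \<and> src G (fst (hd P)) = b \<or>
     k = length (contracted_walk S P) \<and> tgt G (fst (last P)) = b"

text \<open>
  Intersections are indexed by the positions of the common vertex in both contracted walks,
  position 0 being the start. Segments sharing a boundary end share the edge at it; as
  that edge is contracted, the intersection at the neighbour of this end is at the end
  position itself.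
\<close>

definition essential_intersection ::
    "('v, 'a) hourglass_graph \<Rightarrow> 'a strand list \<Rightarrow> 'a strand list \<Rightarrow> nat \<Rightarrow> nat \<Rightarrow> bool" where
  "essential_intersection G P Q k l \<longleftrightarrow>
     crosses_at G P Q k l \<or>
     (\<exists>b\<in>set (bdry G). end_at G (common_darts G P Q) P k b \<and> end_at G (common_darts G P Q) Q l b)"

definition oriented_double_crossing ::
    "('v, 'a) hourglass_graph \<Rightarrow> 'a strand list \<Rightarrow> 'a strand list \<Rightarrow> bool" where
  "oriented_double_crossing G P Q \<longleftrightarrow>
     (\<exists>k k' l l'. k < k' \<and> l < l' \<and>
        essential_intersection G P Q k l \<and> essential_intersection G P Q k' l')"

definition fully_reduced :: "nat \<Rightarrow> ('v, 'a) hourglass_graph \<Rightarrow> bool" where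
  "fully_reduced r G \<longleftrightarrow>
     no_isolated_components G \<and>
     (\<forall>i P. 1 \<le> i \<and> i \<le> r - 1 \<and> trip_segment G i P \<longrightarrow> distinct (visits G P)) \<and>
     (\<forall>i P Q. 1 \<le> i \<and> i \<le> r - 1 \<and> trip_segment G i P \<and> trip_segment G i Q \<and> P \<noteq> Q \<longrightarrow>
        \<not> oriented_double_crossing G P Q) \<and>
     (\<forall>i P Q. 1 \<le> i \<and> i + 1 \<le> r - 1 \<and> trip_segment G i P \<and> trip_segment G (i + 1) Q \<longrightarrow>
        \<not> oriented_double_crossing G P Q)"


subsection \<open>The sub-hourglass graph of a face\<close>

text \<open>
  Let A be the set of arcs of a connected subgraph, and let C be a curve running closely around
  it. The graph inside C has the edges in A; each further arc d at a vertex of A, with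
  multiplicity m, crosses C and is replaced by m simple edges, from the tail of d to the boundary
  vertices \<open>New d 0, \<dots>, New d (m - 1)\<close>, which take the colour of the head of d. The
  arc \<open>Outward d k\<close> points to \<open>New d k\<close>, and \<open>Inward d k\<close> is its opposite.

  The boundary vertices are listed in the order in which C meets the crossing arcs, that is,
  in the order of \<open>contracted_rot G A\<close>, starting from an arc c in A that has the region
  between A and C on its left.
\<close>

datatype ('v, 'a) cut_vertex = Old 'v | New 'a nat

datatype 'a cut_dart = Inside 'a | Outward 'a nat | Inward 'a nat

definition crossing_darts :: "('v, 'a) hourglass_graph \<Rightarrow> 'a set \<Rightarrow> 'a set" where
  "crossing_darts G A = {d \<in> darts G. src G d \<in> src G ` A \<and> d \<notin> A}"

definition crossing_strands :: "('v, 'a) hourglass_graph \<Rightarrow> 'a set \<Rightarrow> 'a strand set" where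
  "crossing_strands G A = {(d, k). d \<in> crossing_darts G A \<and> k < mult G d}"

definition contour :: "('v, 'a) hourglass_graph \<Rightarrow> 'a set \<Rightarrow> 'a \<Rightarrow> 'a list" where
  "contour G A c =
     map (\<lambda>j. (contracted_rot G A ^^ j) c) [0..<card (orbit (contracted_rot G A) c)]"

definition cut_base ::
    "('v, 'a) hourglass_graph \<Rightarrow> 'a set \<Rightarrow> (('v, 'a) cut_vertex, 'a cut_dart) pre_digraph" where
  "cut_base G A = \<lparr>
     verts = Old ` src G ` A \<union> {New d k |d k. (d, k) \<in> crossing_strands G A},
     arcs = Inside ` A \<union> {Outward d k |d k. (d, k) \<in> crossing_strands G A}
              \<union> {Inward d k |d k. (d, k) \<in> crossing_strands G A},
     tail = (\<lambda>e. case e of Inside a \<Rightarrow> Old (src G a)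
                         | Outward d k \<Rightarrow> Old (src G d)
                         | Inward d k \<Rightarrow> New d k),
     head = (\<lambda>e. case e of Inside a \<Rightarrow> Old (tgt G a)
                         | Outward d k \<Rightarrow> New d k
                         | Inward d k \<Rightarrow> Old (src G d)) \<rparr>"

definition cut_first :: "'a set \<Rightarrow> 'a \<Rightarrow> 'a cut_dart" where
  "cut_first A d = (if d \<in> A then Inside d else Outward d 0)"

definition cut_graph ::
    "('v, 'a) hourglass_graph \<Rightarrow> 'a set \<Rightarrow> 'a \<Rightarrow> (('v, 'a) cut_vertex, 'a cut_dart) hourglass_graph"
where
  "cut_graph G A c = \<lparr>
     base = cut_base G A,
     opp = (\<lambda>e. if e \<notin> arcs (cut_base G A) then e else
              case e of Inside a \<Rightarrow> Inside (opp G a)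
                      | Outward d k \<Rightarrow> Inward d k
                      | Inward d k \<Rightarrow> Outward d k),
     rot = (\<lambda>e. if e \<notin> arcs (cut_base G A) then e else
              case e of Inside a \<Rightarrow> cut_first A (rot G a)
                      | Outward d k \<Rightarrow> (if Suc k < mult G d then Outward d (Suc k)
                                        else cut_first A (rot G d))
                      | Inward d k \<Rightarrow> Inward d k),
     mult = (\<lambda>e. case e of Inside a \<Rightarrow> mult G a | _ \<Rightarrow> 1),
     white = (\<lambda>x. case x of Old v \<Rightarrow> white G v | New d k \<Rightarrow> white G (tgt G d)),
     bdry = concat (map (\<lambda>d. map (New d) [0..<mult G d])
                        (filter (\<lambda>d. d \<notin> A) (contour G A c))) \<rparr>"

text \<open>
  For the graph of a face F, the arcs opposite to those of F have the outside of F on their left.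
  The choice of one of them only determines which boundary vertex receives the first label.
\<close>

definition face_graph ::
    "('v, 'a) hourglass_graph \<Rightarrow> 'a set \<Rightarrow> (('v, 'a) cut_vertex, 'a cut_dart) hourglass_graph" where
  "face_graph G F = cut_graph G (F \<union> opp G ` F) (opp G (SOME a. a \<in> F))"

definition fully_reduced_face :: "nat \<Rightarrow> ('v, 'a) hourglass_graph \<Rightarrow> 'a set \<Rightarrow> bool" where
  "fully_reduced_face r G F \<longleftrightarrow> fully_reduced r (face_graph G F)"

end

theory Submission
  imports Defs "HOL-Library.Numeral_Type"
begin

text \<open>
  The graph of a square face is a 4-cycle whose corners carry simple edges to the boundary. Number
  the strands at each corner clockwise by 0, \<dots>, r - 1, the two hourglasses of the square first:
  a trip then adds a constant modulo r to these positions, namely i at white corners and r - i at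
  black ones, so that the shifts at adjacent corners add up to r.

  If m(F) is at most r, a trip cannot traverse three consecutive hourglasses, since two of its turns
  add up to r. Two segments with an oriented double crossing would thus have to go around the square
  from opposite sides, along two hourglasses each, which forces their indices to differ by at least 2.

  If m(F) exceeds r, let T(j) be m(F) without the multiplicity of the hourglass j. If T(j) and
  T(j + 1) exceed r for some j, then a trip runs all the way around the square. Otherwise, T(j) and
  T(j + 2) are at most r for some j. With suitable i, a trip of index i and one of index i + 1 then
  leave the same boundary vertex in opposite directions around the square and cross on the other side.
\<close>

subsection \<open>Trips and contracted walks\<close>

text \<open>Shifts are compared rather than trip indices, because index \<open>i\<close> acts as
  \<open>r - i\<close> at black corners. Let M be the sum of the multiplicities of two adjacent
  hourglasses. A trip following both in the direction of the arcs \<open>A j\<close> needs a shift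
  below M at their common corner. A trip following the other two in the opposite direction needs, in
  a light square, a shift above M at the opposite corner. Opposite corners have equal shifts, which
  is the origin of the gap of 2.

  Crossings refer to a contraction whose vertices are never constructed. For light squares, an
  essential intersection yields that both contracted walks meet in one vertex; functions constant
  along the contracted edges then show that two segments with two such meetings in the same order
  together use all four hourglasses. For heavy squares, the cyclic order around the contracted
  vertex is written out explicitly.

  The case distinction for heavy squares is exhaustive: if no two cyclically adjacent T(j) exceed r,
  those that do lie in one opposite pair, and the other opposite pair satisfies the bounds.\<close>

lemma between_invariant:
  assumes step: "\<And>d. d \<in> D \<Longrightarrow> \<pi> d \<in> D \<and> g (\<pi> d) = g d"
    and "x \<in> D" and "z \<in> between \<pi> x y"
  shows "g z = g x"
proof -
  have "(\<pi> ^^ j) x \<in> D \<and> g ((\<pi> ^^ j) x) = g x" for j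
    by (induction j) (use step \<open>x \<in> D\<close> in auto)
  then show ?thesis using assms(3) by (auto simp: between_def)
qed

text \<open>An interval starting at \<open>x\<close> stops on returning to \<open>x\<close>, so
  \<open>between\<close> makes sense even if \<open>y\<close> is on another cycle. Hence only the
  two pairings follow, not equality of all four values; a walk passing through the vertex supplies
  the missing equality later.\<close>

lemma separates_invariant:
  assumes step: "\<And>d. d \<in> D \<Longrightarrow> \<pi> d \<in> D \<and> g (\<pi> d) = g d"
    and "x \<in> D" "y \<in> D" "separates \<pi> x y z u"
  shows "g z = g x \<and> g u = g y \<or> g u = g x \<and> g z = g y"
  using assms(4) between_invariant[where \<pi> = \<pi> and D = D and g = g, OF step]
    \<open>x \<in> D\<close> \<open>y \<in> D\<close> unfolding separates_def by metis

text \<open>Steps in \<open>S\<close> leave \<open>g\<close> unchanged, so deleting them keeps the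
  remaining steps chained. The claims about the first and last step carry the induction; with
  \<open>S\<close> everything, or everything but one step, the same statement describes walks that
  never cross a cut or cross it once.\<close>

lemma successively_filter_contract:
  assumes "successively (\<lambda>x y. g (t x) = g (s y)) xs"
    and "\<And>x. x \<in> set xs \<Longrightarrow> x \<in> S \<Longrightarrow> g (s x) = g (t x)"
  shows "successively (\<lambda>x y. g (t x) = g (s y)) (filter (\<lambda>a. a \<notin> S) xs) \<and>
         (filter (\<lambda>a. a \<notin> S) xs = [] \<and> (xs \<noteq> [] \<longrightarrow> g (s (hd xs)) = g (t (last xs))) \<or>
          filter (\<lambda>a. a \<notin> S) xs \<noteq> [] \<and>
          g (s (hd (filter (\<lambda>a. a \<notin> S) xs))) = g (s (hd xs)) \<and>
          g (t (last (filter (\<lambda>a. a \<notin> S) xs))) = g (t (last xs)))"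
  using assms
proof (induction xs)
  case Nil
  then show ?case by simp
next
  case (Cons x xs)
  show ?case
  proof (cases "xs = []")
    case True
    then show ?thesis using Cons.prems by auto
  next
    case False
    have "successively (\<lambda>x y. g (t x) = g (s y)) xs" "g (t x) = g (s (hd xs))"
      using Cons.prems(1) False by (auto simp: successively_Cons)
    moreover have "\<And>y. y \<in> set xs \<Longrightarrow> y \<in> S \<Longrightarrow> g (s y) = g (t y)"
      using Cons.prems(2) by auto
    moreover have "x \<in> S \<Longrightarrow> g (s x) = g (t x)" using Cons.prems(2) by auto
    ultimately show ?thesis
      using Cons.IH False by (cases "x \<in> S") (auto simp: successively_Cons)
  qed
qed

lemma successively_nth:
  assumes "successively R xs" "Suc n < length xs"
  shows "R (xs ! n) (xs ! Suc n)"
  using assms by (induction xs arbitrary: n) (auto simp: successively_Cons nth_Cons hd_conv_nth split: nat.splits)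

lemma successively_take: "successively R xs \<Longrightarrow> successively R (take n xs)"
  by (metis append_take_drop_id successively_append_iff)

lemma successively_drop: "successively R xs \<Longrightarrow> successively R (drop n xs)"
  by (metis append_take_drop_id successively_append_iff)

lemma funpow_mod_add:
  fixes f :: "'b \<Rightarrow> 'b"
  assumes "\<And>p. p < n \<Longrightarrow> f (h p) = h (Suc p mod n)" "p < n"
  shows "(f ^^ i) (h p) = h ((p + i) mod n)"
proof (induction i)
  case 0
  then show ?case using assms(2) by simp
next
  case (Suc i)
  have "(p + i) mod n < n" using assms(2) by auto
  then show ?case using Suc assms(1) by (simp add: mod_Suc_eq)
qed


text \<open>The local structure on which turning along strands depends. Both the ambient graph and
  the graph of a square face are instances.\<close>

locale rotation_system =
  fixes H :: "('v, 'a) hourglass_graph"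
  assumes opp_darts: "\<And>d. d \<in> darts H \<Longrightarrow> opp H d \<in> darts H"
    and opp_outside: "\<And>d. d \<notin> darts H \<Longrightarrow> opp H d = d"
    and src_opp: "\<And>d. d \<in> darts H \<Longrightarrow> src H (opp H d) = tgt H d"
    and opp_opp: "\<And>d. d \<in> darts H \<Longrightarrow> opp H (opp H d) = d"
    and rot_permutes_darts: "rot H permutes darts H"
    and src_rot: "\<And>d. d \<in> darts H \<Longrightarrow> src H (rot H d) = src H d"
    and mult_pos_darts: "\<And>d. d \<in> darts H \<Longrightarrow> 0 < mult H d"
    and mult_opp_darts: "\<And>d. d \<in> darts H \<Longrightarrow> mult H (opp H d) = mult H d"
begin

definition strands :: "'a strand set" where
  "strands = {(a, k). a \<in> darts H \<and> k < mult H a}"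

lemma rot_darts: "d \<in> darts H \<Longrightarrow> rot H d \<in> darts H"
  using rot_permutes_darts by (simp add: permutes_in_image)

lemma inv_rot_darts: "d \<in> darts H \<Longrightarrow> inv (rot H) d \<in> darts H"
  using permutes_inv[OF rot_permutes_darts] by (simp add: permutes_in_image)

lemma inv_rot_rot: "inv (rot H) (rot H d) = d"
  using rot_permutes_darts by (rule permutes_inverses(2))

lemma rot_inv_rot: "rot H (inv (rot H) d) = d"
  using rot_permutes_darts by (rule permutes_inverses(1))

lemma tgt_opp: "d \<in> darts H \<Longrightarrow> tgt H (opp H d) = src H d"
  using opp_darts opp_opp src_opp by metis

lemma cw_strand_strands:
  assumes "s \<in> strands"
  shows "cw_strand H s \<in> strands" "src H (fst (cw_strand H s)) = src H (fst s)"
  using assms by (cases s; auto simp: strands_def rot_darts mult_pos_darts src_rot)+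

lemma ccw_cw_strand: "s \<in> strands \<Longrightarrow> ccw_strand H (cw_strand H s) = s"
  by (cases s) (auto simp: strands_def inv_rot_rot)

lemma ccw_strand_strands:
  assumes "s \<in> strands"
  shows "ccw_strand H s \<in> strands" "src H (fst (ccw_strand H s)) = src H (fst s)"
proof -
  have "src H (inv (rot H) a) = src H a" if "a \<in> darts H" for a
    using src_rot[OF inv_rot_darts[OF that]] by (simp add: rot_inv_rot)
  then show "ccw_strand H s \<in> strands" "src H (fst (ccw_strand H s)) = src H (fst s)"
    using assms
    by (cases s; cases "snd s"; auto simp: strands_def inv_rot_darts mult_pos_darts)+
qed

lemma trip_step_strands:
  assumes "s \<in> strands"
  shows "trip_step H i s \<in> strands \<and> src H (fst (trip_step H i s)) = tgt H (fst s)"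
proof -
  obtain a k where s: "s = (a, k)" by (cases s)
  have o: "(opp H a, k) \<in> strands" "src H (opp H a) = tgt H a"
    using assms s by (auto simp: strands_def opp_darts mult_opp_darts src_opp)
  have "(cw_strand H ^^ i) (opp H a, k) \<in> strands \<and>
        src H (fst ((cw_strand H ^^ i) (opp H a, k))) = tgt H a"
    by (induction i) (use o cw_strand_strands in auto)
  moreover have "(ccw_strand H ^^ i) (opp H a, k) \<in> strands \<and>
        src H (fst ((ccw_strand H ^^ i) (opp H a, k))) = tgt H a"
    by (induction i) (use o ccw_strand_strands in auto)
  ultimately show ?thesis by (simp add: trip_step_def s)
qed

lemma trip_segment_strands: "trip_segment H i P \<Longrightarrow> set P \<subseteq> strands"
  by (auto simp: trip_segment_def strands_def)

text \<open>\<open>common_darts\<close> ranges over the whole type; \<open>opp_outside\<close>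
  prevents an element outside the arcs from entering because its opposite is an arc.\<close>

lemma common_darts_darts:
  assumes "trip_segment H i P"
  shows "common_darts H P Q \<subseteq> darts H"
  using trip_segment_strands[OF assms] opp_outside
  by (fastforce simp: common_darts_def strands_def)

lemma trip_segment_nth:
  assumes "trip_segment H i P" "Suc j < length P"
  shows "P ! Suc j = trip_step H i (P ! j)" "tgt H (fst (P ! j)) \<notin> set (bdry H)"
    "src H (fst (P ! Suc j)) = tgt H (fst (P ! j))"
proof -
  show 1: "P ! Suc j = trip_step H i (P ! j)" "tgt H (fst (P ! j)) \<notin> set (bdry H)"
    using assms by (auto simp: trip_segment_def)
  have "P ! j \<in> strands" using trip_segment_strands[OF assms(1)] assms(2) by auto
  then show "src H (fst (P ! Suc j)) = tgt H (fst (P ! j))"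
    using trip_step_strands 1 by simp
qed

lemma trip_segment_successively:
  assumes "trip_segment H i P"
  shows "successively (\<lambda>x y. tgt H x = src H y) (map fst P)"
  using trip_segment_nth(3)[OF assms] by (simp add: successively_conv_nth)

lemma visits_nth:
  assumes "trip_segment H i P" "n < length P"
  shows "visits H P ! n = src H (fst (P ! n))" "visits H P ! Suc n = tgt H (fst (P ! n))"
proof -
  show "visits H P ! Suc n = tgt H (fst (P ! n))"
    using assms(2) by (simp add: visits_def)
  show "visits H P ! n = src H (fst (P ! n))"
    using assms trip_segment_nth(3)[OF assms(1), of "n - 1"]
    by (cases n) (auto simp: visits_def hd_conv_nth)
qed

text \<open>A function on the vertices that is constant along the contracted edges is constant around the
  vertices resulting from the contraction. Such functions stand in for the components of the
  contracted edges.\<close>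

lemma crosses_at_invariant:
  assumes "trip_segment H i P" "trip_segment H i' Q" "crosses_at H P Q k l"
    and g: "\<And>d. d \<in> common_darts H P Q \<Longrightarrow> g (src H d) = g (tgt H d)"
  defines "p \<equiv> contracted_walk (common_darts H P Q) P"
    and "q \<equiv> contracted_walk (common_darts H P Q) Q"
  shows "0 < k \<and> k < length p \<and> 0 < l \<and> l < length q"
    and "g (src H (p ! k)) = g (src H (q ! l)) \<and>
         g (tgt H (p ! (k - 1))) = g (src H (p ! k)) \<and> g (tgt H (q ! (l - 1))) = g (src H (q ! l))"
proof -
  let ?S = "common_darts H P Q" and ?\<pi> = "contracted_rot H (common_darts H P Q)"
  show kl: "0 < k \<and> k < length p \<and> 0 < l \<and> l < length q"
    using assms(3) by (simp add: crosses_at_def Let_def p_def q_def)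
  have sep: "separates ?\<pi> (opp H (p ! (k - 1))) (p ! k) (opp H (q ! (l - 1))) (q ! l)"
    using assms(3) by (simp add: crosses_at_def Let_def p_def q_def)
  have chain: "successively (\<lambda>x y. g (tgt H x) = g (src H y)) (contracted_walk ?S R)"
    if "trip_segment H n R" for n R
    unfolding contracted_walk_def
    using successively_filter_contract[of g "tgt H" "src H" "map fst R" ?S] g
      successively_mono[OF trip_segment_successively[OF that]] by simp
  have darts: "set (contracted_walk ?S R) \<subseteq> darts H" if "trip_segment H n R" for n R
    using trip_segment_strands[OF that] by (auto simp: contracted_walk_def strands_def)
  have 1: "g (tgt H (p ! (k - 1))) = g (src H (p ! k))"
    using successively_nth[OF chain[OF assms(1)], of "k - 1"] kl by (simp add: p_def)
  have 2: "g (tgt H (q ! (l - 1))) = g (src H (q ! l))"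
    using successively_nth[OF chain[OF assms(2)], of "l - 1"] kl by (simp add: q_def)
  have in_darts: "p ! (k - 1) \<in> darts H" "p ! k \<in> darts H" "q ! (l - 1) \<in> darts H"
    using darts[OF assms(1), folded p_def] darts[OF assms(2), folded q_def] kl
      nth_mem[of k p] nth_mem[of "k - 1" p] nth_mem[of "l - 1" q]
    by (simp_all add: subset_iff less_imp_diff_less)
  have step: "?\<pi> d \<in> darts H \<and> g (src H (?\<pi> d)) = g (src H d)" if "d \<in> darts H" for d
    using that g[of d] by (auto simp: contracted_rot_def rot_darts opp_darts src_rot src_opp)
  have "g (src H (opp H (q ! (l - 1)))) = g (src H (opp H (p ! (k - 1)))) \<and>
        g (src H (q ! l)) = g (src H (p ! k)) \<or>
        g (src H (q ! l)) = g (src H (opp H (p ! (k - 1)))) \<and>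
        g (src H (opp H (q ! (l - 1)))) = g (src H (p ! k))"
    using separates_invariant[where \<pi> = ?\<pi> and D = "darts H" and g = "\<lambda>d. g (src H d)", OF step
        opp_darts[OF in_darts(1)] in_darts(2) sep] by simp
  then show "g (src H (p ! k)) = g (src H (q ! l)) \<and>
         g (tgt H (p ! (k - 1))) = g (src H (p ! k)) \<and> g (tgt H (q ! (l - 1))) = g (src H (q ! l))"
    using 1 2 in_darts by (auto simp: src_opp)
qed

text \<open>With both positions before the ends of the walks, a shared boundary end can only be a
  common start, and the contracted steps before the first remaining arc do not change
  \<open>g\<close>.\<close>

lemma essential_start_invariant:
  assumes "trip_segment H i P" "trip_segment H i' Q" "essential_intersection H P Q k l"
    and g: "\<And>d. d \<in> common_darts H P Q \<Longrightarrow> g (src H d) = g (tgt H d)"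
  defines "p \<equiv> contracted_walk (common_darts H P Q) P"
    and "q \<equiv> contracted_walk (common_darts H P Q) Q"
  assumes "k < length p" "l < length q"
  shows "g (src H (p ! k)) = g (src H (q ! l))"
proof (cases "crosses_at H P Q k l")
  case True
  then show ?thesis
    using crosses_at_invariant(2)[OF assms(1,2) _ g] by (simp add: p_def q_def)
next
  case False
  then have *: "k = 0" "l = 0" "src H (fst (hd P)) = src H (fst (hd Q))"
    using assms(3,7,8) by (auto simp: essential_intersection_def end_at_def p_def q_def)
  have "g (src H (hd (contracted_walk (common_darts H P Q) R))) = g (src H (hd (map fst R)))"
    if "trip_segment H n R" "contracted_walk (common_darts H P Q) R \<noteq> []" for n R
    using successively_filter_contract[of g "tgt H" "src H" "map fst R" "common_darts H P Q"] g
      successively_mono[OF trip_segment_successively[OF that(1)]] that(2)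
    by (simp add: contracted_walk_def)
  from this[OF assms(1)] this[OF assms(2)]
  have "g (src H (hd p)) = g (src H (hd q))"
    using * assms(1,2,7,8) by (simp add: p_def q_def trip_segment_def hd_map)
  moreover have "p \<noteq> []" "q \<noteq> []" using assms(7,8) by auto
  ultimately show ?thesis using * by (simp add: hd_conv_nth)
qed

text \<open>Positive positions leave only a common far end. Such an end sits at position
  \<open>length p\<close>, one past the last arc, hence the weak bounds.\<close>

lemma essential_end_invariant:
  assumes "trip_segment H i P" "trip_segment H i' Q" "essential_intersection H P Q k l"
    and g: "\<And>d. d \<in> common_darts H P Q \<Longrightarrow> g (src H d) = g (tgt H d)"
  defines "p \<equiv> contracted_walk (common_darts H P Q) P"
    and "q \<equiv> contracted_walk (common_darts H P Q) Q"
  assumes "0 < k" "0 < l"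
  shows "k \<le> length p \<and> l \<le> length q \<and> g (tgt H (p ! (k - 1))) = g (tgt H (q ! (l - 1)))"
proof (cases "crosses_at H P Q k l")
  case True
  then show ?thesis
    using crosses_at_invariant[OF assms(1,2) _ g] by (fastforce simp: p_def q_def)
next
  case False
  then have *: "k = length p" "l = length q" "tgt H (fst (last P)) = tgt H (fst (last Q))"
    using assms(3,7,8) by (auto simp: essential_intersection_def end_at_def p_def q_def)
  have "g (tgt H (last (contracted_walk (common_darts H P Q) R))) = g (tgt H (last (map fst R)))"
    if "trip_segment H n R" "contracted_walk (common_darts H P Q) R \<noteq> []" for n R
    using successively_filter_contract[of g "tgt H" "src H" "map fst R" "common_darts H P Q"] g
      successively_mono[OF trip_segment_successively[OF that(1)]] that(2)
    by (simp add: contracted_walk_def)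
  from this[OF assms(1)] this[OF assms(2)]
  have "g (tgt H (last p)) = g (tgt H (last q))"
    using * assms(1,2,7,8) by (simp add: p_def q_def trip_segment_def last_map)
  moreover have "p \<noteq> []" "q \<noteq> []" using * assms(7,8) by auto
  ultimately show ?thesis using * by (simp add: last_conv_nth)
qed

text \<open>The pieces are the parts of the contracted walks between the two intersections. They are
  fixed before \<open>g\<close>, so that several cuts of the vertices, each a Boolean
  \<open>g\<close>, can be tried on the same pieces.\<close>

lemma oriented_double_crossing_pieces:
  assumes "trip_segment H i P" "trip_segment H i' Q" "oriented_double_crossing H P Q"
  defines "S \<equiv> common_darts H P Q"
  obtains p k n q l n' where
    "p = take n (drop k (contracted_walk S P))" "p \<noteq> []"
    "q = take n' (drop l (contracted_walk S Q))" "q \<noteq> []"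
    "\<And>g :: 'v \<Rightarrow> bool. (\<And>d. d \<in> S \<Longrightarrow> g (src H d) = g (tgt H d)) \<Longrightarrow>
       successively (\<lambda>x y. g (tgt H x) = g (src H y)) p \<and>
       successively (\<lambda>x y. g (tgt H x) = g (src H y)) q \<and>
       g (src H (hd p)) = g (src H (hd q)) \<and> g (tgt H (last p)) = g (tgt H (last q))"
proof -
  obtain k k' l l' where kl: "k < k'" "l < l'" "essential_intersection H P Q k l"
    "essential_intersection H P Q k' l'"
    using assms(3) by (auto simp: oriented_double_crossing_def)
  let ?P = "contracted_walk S P" and ?Q = "contracted_walk S Q"
  \<comment> \<open>A constant function says nothing about vertices; the invariant is applied here
    for its bounds.\<close>
  have len: "k' \<le> length ?P" "l' \<le> length ?Q"
    using essential_end_invariant[OF assms(1,2) kl(4), where g = "\<lambda>_. ()"] kl(1,2)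
    by (auto simp: S_def)
  define p where "p = take (k' - k) (drop k ?P)"
  define q where "q = take (l' - l) (drop l ?Q)"
  have ne: "p \<noteq> []" "q \<noteq> []" using len kl by (auto simp: p_def q_def)
  have ends: "hd p = ?P ! k" "hd q = ?Q ! l" "last p = ?P ! (k' - 1)" "last q = ?Q ! (l' - 1)"
    using len kl ne by (auto simp: p_def q_def hd_conv_nth last_conv_nth)
  show thesis
  proof (rule that[OF p_def ne(1) q_def ne(2)])
    fix g :: "'v \<Rightarrow> bool"
    assume g: "\<And>d. d \<in> S \<Longrightarrow> g (src H d) = g (tgt H d)"
    have "successively (\<lambda>x y. g (tgt H x) = g (src H y)) (contracted_walk S R)"
      if "trip_segment H n R" for n R
      unfolding contracted_walk_def
      using successively_filter_contract[of g "tgt H" "src H" "map fst R" S] g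
        successively_mono[OF trip_segment_successively[OF that]] by simp
    from this[OF assms(1)] this[OF assms(2)]
    show "successively (\<lambda>x y. g (tgt H x) = g (src H y)) p \<and>
       successively (\<lambda>x y. g (tgt H x) = g (src H y)) q \<and>
       g (src H (hd p)) = g (src H (hd q)) \<and> g (tgt H (last p)) = g (tgt H (last q))"
      using essential_start_invariant[OF assms(1,2) kl(3), of g]
        essential_end_invariant[OF assms(1,2) kl(4), of g] g len kl(1,2) ends
      by (simp add: p_def q_def successively_take successively_drop S_def)
  qed
qed

end

subsection \<open>The square with its boundary edges\<close>

lemma exhaust_index4: "(j :: 4) = f \<or> j = f + 1 \<or> j = f + 2 \<or> j = f + 3"
proof -
  have "x = 0 \<or> x = 1 \<or> x = 2 \<or> x = 3" for x :: 4
  proof (cases x)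
    case (of_int z)
    then consider "z = 0" | "z = 1" | "z = 2" | "z = 3" by fastforce
    then show ?thesis using of_int by cases auto
  qed
  from this[of "j - f"] show ?thesis by (auto simp: algebra_simps)
qed

text \<open>Normal forms for cyclic indices; in particular the predecessor of \<open>j\<close> is
  always written \<open>j + 3\<close>.\<close>

lemma index4_simps [simp]:
  "(j :: 4) + 1 + 1 = j + 2" "j + 1 + 2 = j + 3" "j + 1 + 3 = j"
  "j + 2 + 1 = j + 3" "j + 2 + 2 = j" "j + 2 + 3 = j + 1"
  "j + 3 + 1 = j" "j + 3 + 2 = j + 1" "j + 3 + 3 = j + 2"
  "j + 4 = j" "j + 5 = j + 1" "j + 6 = j + 2"
  by (simp_all add: add.assoc)

text \<open>Indices are taken modulo 4, so \<open>j + 3\<close> precedes \<open>j\<close>. The arcs at the corner \<open>V j\<close> are, clockwise,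
  \<open>B (j + 3)\<close>, \<open>A j\<close>, \<open>X j 0\<close>, \<dots>, \<open>X j (n j - 1)\<close>; \<open>L j t\<close> is the boundary vertex at the end
  of \<open>X j t\<close>. The values of \<open>L\<close>, \<open>X\<close> and \<open>E\<close> for \<open>t \<ge> n j\<close> are junk.\<close>

lemma numeral_index4: "(4 :: 4) = 0" "(5 :: 4) = 1" "(6 :: 4) = 2"
  by simp_all

locale framed_square =
  fixes r :: nat and H :: "('v, 'a) hourglass_graph"
    and m n :: "4 \<Rightarrow> nat" and V :: "4 \<Rightarrow> 'v" and L :: "4 \<Rightarrow> nat \<Rightarrow> 'v"
    and A B :: "4 \<Rightarrow> 'a" and X E :: "4 \<Rightarrow> nat \<Rightarrow> 'a"
  assumes m_pos: "\<And>j. 0 < m j"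
    and degree: "\<And>j. m (j + 3) + m j + n j = r"
    and verts_eq: "verts (base H) = range V \<union> {L j t |j t. t < n j}"
    and darts_eq: "darts H = range A \<union> range B \<union> {X j t |j t. t < n j} \<union> {E j t |j t. t < n j}"
    and src_A: "\<And>j. src H (A j) = V j" and tgt_A: "\<And>j. tgt H (A j) = V (j + 1)"
    and src_B: "\<And>j. src H (B j) = V (j + 1)" and tgt_B: "\<And>j. tgt H (B j) = V j"
    and src_X: "\<And>j t. t < n j \<Longrightarrow> src H (X j t) = V j"
    and tgt_X: "\<And>j t. t < n j \<Longrightarrow> tgt H (X j t) = L j t"
    and src_E: "\<And>j t. t < n j \<Longrightarrow> src H (E j t) = L j t"
    and tgt_E: "\<And>j t. t < n j \<Longrightarrow> tgt H (E j t) = V j"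
    and opp_A: "\<And>j. opp H (A j) = B j" and opp_B: "\<And>j. opp H (B j) = A j"
    and opp_X: "\<And>j t. t < n j \<Longrightarrow> opp H (X j t) = E j t"
    and opp_E: "\<And>j t. t < n j \<Longrightarrow> opp H (E j t) = X j t"
    and opp_outside: "\<And>d. d \<notin> darts H \<Longrightarrow> opp H d = d"
    and rot_outside: "\<And>d. d \<notin> darts H \<Longrightarrow> rot H d = d"
    and rot_B: "\<And>j. rot H (B (j + 3)) = A j"
    and rot_A: "\<And>j. rot H (A j) = (if n j = 0 then B (j + 3) else X j 0)"
    and rot_X: "\<And>j t. t < n j \<Longrightarrow>
      rot H (X j t) = (if Suc t < n j then X j (Suc t) else B (j + 3))"
    and rot_E: "\<And>j t. t < n j \<Longrightarrow> rot H (E j t) = E j t"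
    and mult_A: "\<And>j. mult H (A j) = m j" and mult_B: "\<And>j. mult H (B j) = m j"
    and mult_X: "\<And>j t. t < n j \<Longrightarrow> mult H (X j t) = 1"
    and mult_E: "\<And>j t. t < n j \<Longrightarrow> mult H (E j t) = 1"
    and white_V: "\<And>j. white H (V (j + 1)) \<longleftrightarrow> \<not> white H (V j)"
    and bdry_eq: "set (bdry H) = {L j t |j t. t < n j}"
    and V_eq: "\<And>i j. V i = V j \<longleftrightarrow> i = j"
    and L_eq: "\<And>i j s t. s < n i \<Longrightarrow> t < n j \<Longrightarrow> L i s = L j t \<longleftrightarrow> i = j \<and> s = t"
    and V_neq_L: "\<And>i j t. t < n j \<Longrightarrow> V i \<noteq> L j t"
    and A_neq_B: "\<And>i j. A i \<noteq> B j"
    and A_neq_X: "\<And>i j t. t < n j \<Longrightarrow> A i \<noteq> X j t"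
    and B_neq_X: "\<And>i j t. t < n j \<Longrightarrow> B i \<noteq> X j t"
begin

lemma A_eq: "A i = A j \<longleftrightarrow> i = j"
  using src_A V_eq by metis

lemma B_eq: "B i = B j \<longleftrightarrow> i = j"
  using tgt_B V_eq by metis

lemma X_eq: "s < n i \<Longrightarrow> t < n j \<Longrightarrow> X i s = X j t \<longleftrightarrow> i = j \<and> s = t"
  using tgt_X L_eq by metis

lemma E_eq: "s < n i \<Longrightarrow> t < n j \<Longrightarrow> E i s = E j t \<longleftrightarrow> i = j \<and> s = t"
  using src_E L_eq by metis

lemma E_neq:
  assumes "t < n j"
  shows "E j t \<noteq> A i" "E j t \<noteq> B i" "s < n i \<Longrightarrow> E j t \<noteq> X i s"
  using assms src_E src_A src_B src_X V_neq_L by metis+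

lemmas A_neq_E = E_neq(1)[symmetric] and B_neq_E = E_neq(2)[symmetric]
  and X_neq_E = E_neq(3)[symmetric]

lemmas V_neq_L' = V_neq_L[symmetric]

lemmas dart_eqs = A_eq B_eq X_eq E_eq A_neq_B A_neq_B[symmetric] A_neq_X A_neq_X[symmetric]
  B_neq_X B_neq_X[symmetric] E_neq A_neq_E B_neq_E X_neq_E

lemmas ends = src_A tgt_A src_B tgt_B src_X tgt_X src_E tgt_E

lemma in_darts: "A j \<in> darts H" "B j \<in> darts H" "t < n j \<Longrightarrow> X j t \<in> darts H"
  "t < n j \<Longrightarrow> E j t \<in> darts H"
  by (auto simp: darts_eq)

lemma darts_cases:
  assumes "d \<in> darts H"
  obtains (A) j where "d = A j" | (B) j where "d = B j"
    | (X) j t where "t < n j" "d = X j t" | (E) j t where "t < n j" "d = E j t"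
  using assms by (auto simp: darts_eq)

lemma m_degree: "m j + m (j + 1) + n (j + 1) = r"
  using degree[of "j + 1"] by simp

lemma m_le_r: "m j + m (j + 1) \<le> r" "m (j + 3) + m j \<le> r"
  using m_degree[of j] degree[of j] by linarith+

lemma finite_darts: "finite (darts H)"
proof -
  have "{X j t |j t. t < n j} = (\<Union>j. X j ` {..<n j})" "{E j t |j t. t < n j} = (\<Union>j. E j ` {..<n j})"
    by auto
  then show ?thesis by (simp add: darts_eq)
qed

text \<open>On a finite set surjectivity suffices, so it is enough to name the predecessor of every
  arc.\<close>

lemma rot_permutes': "rot H permutes darts H"
proof (rule bij_imp_permutes)
  have into: "rot H ` darts H \<subseteq> darts H"
  proof clarify
    fix d assume "d \<in> darts H"
    then show "rot H d \<in> darts H"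
    proof (cases rule: darts_cases)
      case (B j)
      then show ?thesis using rot_B[of "j + 1"] by (simp add: in_darts)
    qed (auto simp: rot_A rot_X rot_E in_darts)
  qed
  moreover have "darts H \<subseteq> rot H ` darts H"
  proof
    fix d assume "d \<in> darts H"
    then show "d \<in> rot H ` darts H"
    proof (cases rule: darts_cases)
      case (A j)
      then show ?thesis using rot_B[of j] in_darts by (intro image_eqI[of _ _ "B (j + 3)"]) auto
    next
      case (B j)
      have "rot H (if n (j + 1) = 0 then A (j + 1) else X (j + 1) (n (j + 1) - 1)) = B j"
        using rot_A[of "j + 1"] rot_X[of "n (j + 1) - 1" "j + 1"] by simp
      then show ?thesis using B in_darts by (intro image_eqI[OF sym]) auto
    next
      case (X j t)
      then have "rot H (if t = 0 then A j else X j (t - 1)) = d"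
        using rot_A[of j] rot_X[of "t - 1" j] by simp
      then show ?thesis using in_darts X by (intro image_eqI[OF sym]) auto
    next
      case (E j t)
      then show ?thesis using rot_E in_darts by (intro image_eqI[of _ _ "E j t"]) auto
    qed
  qed
  ultimately have "rot H ` darts H = darts H" by blast
  then show "bij_betw (rot H) (darts H) (darts H)"
    using finite_darts by (simp add: bij_betw_def eq_card_imp_inj_on)
qed (simp add: rot_outside)

sublocale rotation_system H
proof
  fix d assume d: "d \<in> darts H"
  show "src H (rot H d) = src H d"
    using d
  proof (cases rule: darts_cases)
    case (B j)
    have "rot H (B ((j + 1) + 3)) = A (j + 1)" by (rule rot_B)
    then show ?thesis using B by (simp add: ends)
  qed (auto simp: rot_A rot_X rot_E ends)
  show "opp H d \<in> darts H" "src H (opp H d) = tgt H d" "opp H (opp H d) = d"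
    "0 < mult H d" "mult H (opp H d) = mult H d"
    using d by (auto elim!: darts_cases simp: opp_A opp_B opp_X opp_E in_darts ends m_pos
        mult_A mult_B mult_X mult_E)
qed (simp_all add: opp_outside rot_permutes')


text \<open>Counting starts at \<open>B (j + 3)\<close>. A trip arriving at \<open>V (j + 1)\<close>
  on strand \<open>k\<close> of \<open>A j\<close> thus turns from position \<open>k\<close>,
  whereas arriving at \<open>V j\<close> on strand \<open>k\<close> of \<open>B j\<close> it turns
  from position \<open>m (j + 3) + k\<close>.\<close>

definition pos :: "4 \<Rightarrow> nat \<Rightarrow> 'a strand" where
  "pos j p = (if p < m (j + 3) then (B (j + 3), p)
     else if p < m (j + 3) + m j then (A j, p - m (j + 3))
     else (X j (p - (m (j + 3) + m j)), 0))"

lemma pos_simps: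
  "k < m j \<Longrightarrow> pos (j + 1) k = (B j, k)"
  "k < m j \<Longrightarrow> pos j (m (j + 3) + k) = (A j, k)"
  "pos j (m (j + 3) + m j + t) = (X j t, 0)"
  by (auto simp: pos_def)

lemma pos_strands: "p < r \<Longrightarrow> pos j p \<in> strands"
  using degree[of j] by (auto simp: pos_def strands_def in_darts mult_A mult_B mult_X)

lemma cw_pos:
  assumes "p < r"
  shows "cw_strand H (pos j p) = pos j (Suc p mod r)"
proof -
  have mp: "0 < m j" "0 < m (j + 3)" using m_pos by auto
  consider "Suc p < m (j + 3)" | "Suc p = m (j + 3)" | "m (j + 3) \<le> p" "Suc p < m (j + 3) + m j"
    | "Suc p = m (j + 3) + m j" | "m (j + 3) + m j \<le> p" by linarith
  then show ?thesis
  proof cases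
    case 5
    then show ?thesis
      using assms mp degree[of j] by (cases "Suc p = r") (auto simp: pos_def mult_X rot_X Suc_diff_le)
  qed (use assms mp degree[of j] in
      \<open>auto simp: pos_def mult_A mult_B rot_A rot_B mod_less_eq_dividend mod_if\<close>)
qed

lemma cw_funpow_pos: "p < r \<Longrightarrow> (cw_strand H ^^ i) (pos j p) = pos j ((p + i) mod r)"
  by (rule funpow_mod_add) (auto simp: cw_pos)

lemma ccw_funpow_cw_funpow:
  "s \<in> strands \<Longrightarrow> (ccw_strand H ^^ i) ((cw_strand H ^^ i) s) = s"
proof (induction i arbitrary: s)
  case (Suc i)
  have "(cw_strand H ^^ i) s \<in> strands" for i
    by (induction i) (use Suc.prems cw_strand_strands in auto)
  then show ?case
    using Suc by (simp add: funpow_swap1[of "ccw_strand H"] ccw_cw_strand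
        del: cw_strand.simps ccw_strand.simps)
qed simp

text \<open>A counterclockwise turn by \<open>i\<close> undoes a clockwise one, and \<open>r\<close>
  clockwise steps lead once around the corner.\<close>

lemma ccw_funpow_pos:
  assumes "p < r" "i \<le> r"
  shows "(ccw_strand H ^^ i) (pos j p) = pos j ((p + (r - i)) mod r)"
proof -
  have lt: "(p + (r - i)) mod r < r" using assms by auto
  have "((p + (r - i)) mod r + i) mod r = p"
    using assms by (simp add: mod_add_left_eq)
  then have "pos j p = (cw_strand H ^^ i) (pos j ((p + (r - i)) mod r))"
    by (simp add: cw_funpow_pos[OF lt])
  then show ?thesis using ccw_funpow_cw_funpow[OF pos_strands[OF lt]] by simp
qed

definition shift :: "nat \<Rightarrow> 4 \<Rightarrow> nat" where
  "shift i j = (if white H (V j) then i else r - i)"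

lemma shift_simps:
  assumes "i \<le> r"
  shows "shift i (j + 1) = r - shift i j" "shift i (j + 2) = shift i j"
    "shift i (j + 3) = r - shift i j"
proof -
  have *: "shift i (j + 1) = r - shift i j" for j
    using assms by (auto simp: shift_def white_V)
  have le: "shift i j \<le> r" for j using assms by (auto simp: shift_def)
  show "shift i (j + 1) = r - shift i j" by (rule *)
  show "shift i (j + 2) = shift i j"
    using *[of j] *[of "j + 1"] le[of j] by simp
  show "shift i (j + 3) = r - shift i j"
    using *[of j] *[of "j + 1"] *[of "j + 2"] le[of j] by simp
qed

lemma shift_less: "1 \<le> i \<Longrightarrow> i \<le> r - 1 \<Longrightarrow> 0 < shift i j \<and> shift i j < r"
  by (auto simp: shift_def)

lemma trip_step_pos:
  assumes "i \<le> r" "d \<in> darts H" "tgt H d = V j" "(opp H d, k) = pos j p" "p < r"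
  shows "trip_step H i (d, k) = pos j ((p + shift i j) mod r)"
  using assms cw_funpow_pos ccw_funpow_pos by (simp add: trip_step_def shift_def)

lemma trip_step_A:
  assumes "i \<le> r" "k < m j"
  shows "trip_step H i (A j, k) = pos (j + 1) ((k + shift i (j + 1)) mod r)"
  using assms m_le_r(1)[of j] by (intro trip_step_pos) (auto simp: in_darts tgt_A opp_A pos_simps)

lemma trip_step_B:
  assumes "i \<le> r" "k < m j"
  shows "trip_step H i (B j, k) = pos j ((m (j + 3) + k + shift i j) mod r)"
  using assms m_le_r(2)[of j] by (intro trip_step_pos) (auto simp: in_darts tgt_B opp_B pos_simps)

lemma trip_step_E:
  assumes "i \<le> r" "t < n j"
  shows "trip_step H i (E j t, 0) = pos j ((m (j + 3) + m j + t + shift i j) mod r)"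
  using assms degree[of j] by (intro trip_step_pos) (auto simp: in_darts tgt_E opp_E pos_simps)

end

subsection \<open>Light squares are fully reduced\<close>

text \<open>If an edge were traversed in both directions, each traversal would start where the other
  ends. As no vertex is visited twice, each would have to come immediately after the other.\<close>

lemma distinct_visits_edges:
  assumes "rotation_system H" "trip_segment H i P" "distinct (visits H P)"
  shows "distinct (map fst P)" and "d \<in> fst ` set P \<Longrightarrow> opp H d \<notin> fst ` set P"
proof -
  interpret rotation_system H by (fact assms(1))
  have len: "length (visits H P) = Suc (length P)" by (simp add: visits_def)
  have inj: "a = b" if "visits H P ! a = visits H P ! b" "a \<le> length P" "b \<le> length P" for a b
    using assms(3) len that nth_eq_iff_index_eq less_Suc_eq_le by metis
  show "distinct (map fst P)"
    using inj visits_nth(1)[OF assms(2)] by (auto simp: distinct_conv_nth)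
  show "opp H d \<notin> fst ` set P" if d: "d \<in> fst ` set P"
  proof
    assume "opp H d \<in> fst ` set P"
    then obtain a b where ab: "a < length P" "b < length P" "fst (P ! a) = d" "fst (P ! b) = opp H d"
      using d by (auto simp: in_set_conv_nth)
    have "P ! a \<in> strands" using trip_segment_strands[OF assms(2)] ab by auto
    then have dd: "d \<in> darts H" using ab by (auto simp: strands_def)
    have "b = Suc a" "Suc b = a"
      using inj[of b "Suc a"] inj[of "Suc b" a] visits_nth[OF assms(2)] ab dd src_opp tgt_opp by auto
    then show False by simp
  qed
qed

lemma successively_no_change:
  assumes "successively (\<lambda>x y. g (t x) = g (s y)) xs" "xs \<noteq> []"
    and "\<And>x. x \<in> set xs \<Longrightarrow> g (s x) = g (t x)"
  shows "g (s (hd xs)) = g (t (last xs))"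
  using successively_filter_contract[of g t s xs UNIV] assms by simp

text \<open>Contracting every step except \<open>d\<close> leaves the one-step walk
  \<open>[d]\<close>; distinctness of the steps excludes a second occurrence of
  \<open>d\<close>.\<close>

lemma successively_one_change:
  assumes "successively (\<lambda>x y. g (t x) = g (s y)) xs" "d \<in> set xs" "distinct xs"
    and "\<And>x. x \<in> set xs \<Longrightarrow> x \<noteq> d \<Longrightarrow> g (s x) = g (t x)"
  shows "g (s (hd xs)) = g (s d)" "g (t (last xs)) = g (t d)"
proof -
  have "filter (\<lambda>a. a \<notin> - {d}) xs = [d]"
    using assms(2,3) by (induction xs) (auto simp: filter_empty_conv)
  then show "g (s (hd xs)) = g (s d)" "g (t (last xs)) = g (t d)"
    using successively_filter_contract[of g t s xs "- {d}"] assms by auto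
qed

lemma (in rotation_system) trip_segment_Cons2:
  assumes "trip_segment H i (s # s' # P)"
  shows "trip_segment H i (s' # P)" "s' = trip_step H i s" "tgt H (fst s) \<notin> set (bdry H)"
    "\<not> turns_back H i s"
proof -
  show "s' = trip_step H i s" "tgt H (fst s) \<notin> set (bdry H)"
    using trip_segment_nth[OF assms, of 0] by auto
  show "\<not> turns_back H i s"
    using assms by (simp add: trip_segment_def)
  have "tgt H (fst ((s' # P) ! j)) \<notin> set (bdry H) \<and> (s' # P) ! Suc j = trip_step H i ((s' # P) ! j)"
    if "Suc j < length (s' # P)" for j
    using trip_segment_nth(1,2)[OF assms, of "Suc j"] that by simp
  then show "trip_segment H i (s' # P)"
    using assms unfolding trip_segment_def by simp
qed

text \<open>With edge \<open>j\<close> joining the corners \<open>j\<close> and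
  \<open>j + 1\<close>, removing two edges from the 4-cycle leaves two paths; \<open>J\<close> is
  the set of corners of one of them.\<close>

lemma cyclic_cut:
  fixes f f' :: 4
  assumes "f \<noteq> f'"
  obtains J where "\<And>j. ((j \<in> J) = (j + 1 \<in> J)) \<longleftrightarrow> j \<noteq> f \<and> j \<noteq> f'"
proof -
  consider "f' = f + 1" | "f' = f + 2" | "f' = f + 3"
    using exhaust_index4[of f' f] assms by auto
  then show thesis
  proof cases
    case 1
    show thesis
    proof (rule that[of "{f + 1}"])
      show "((j \<in> {f + 1}) = (j + 1 \<in> {f + 1})) \<longleftrightarrow> j \<noteq> f \<and> j \<noteq> f'" for j
        using exhaust_index4[of j f] 1 by auto
    qed
  next
    case 2
    show thesis
    proof (rule that[of "{f + 1, f + 2}"])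
      show "((j \<in> {f + 1, f + 2}) = (j + 1 \<in> {f + 1, f + 2})) \<longleftrightarrow> j \<noteq> f \<and> j \<noteq> f'" for j
        using exhaust_index4[of j f] 2 by auto
    qed
  next
    case 3
    show thesis
    proof (rule that[of "{f}"])
      show "((j \<in> {f}) = (j + 1 \<in> {f})) \<longleftrightarrow> j \<noteq> f \<and> j \<noteq> f'" for j
        using exhaust_index4[of j f] 3 by auto
    qed
  qed
qed

section \<open>Shapes of trip segments in a light square\<close>

context framed_square
begin

lemma L_bdry: "t < n j \<Longrightarrow> L j t \<in> set (bdry H)"
  by (auto simp: bdry_eq)

lemma V_not_bdry: "V j \<notin> set (bdry H)"
  by (auto simp: bdry_eq V_neq_L)

lemma pos_cases:
  assumes "pos j p = (d, k)" "p < r"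
  obtains (B) "d = B (j + 3)" "p = k" "k < m (j + 3)"
  | (A) "d = A j" "p = m (j + 3) + k" "k < m j"
  | (X) t where "t < n j" "d = X j t" "p = m (j + 3) + m j + t"
proof -
  consider "p < m (j + 3)" | "m (j + 3) \<le> p" "p < m (j + 3) + m j" | "m (j + 3) + m j \<le> p"
    by linarith
  then show thesis
  proof cases
    case 1
    then show thesis using assms B by (simp add: pos_def)
  next
    case 2
    then show thesis using assms A by (auto simp: pos_def)
  next
    case 3
    then show thesis
      using assms degree[of j] X[of "p - (m (j + 3) + m j)"] by (simp add: pos_def)
  qed
qed

lemma add_mod_less: "p < r \<Longrightarrow> s < r \<Longrightarrow> (p + s) mod r = (if p + s < r then p + s else p + s - r)"
  by (simp add: mod_if)

text \<open>Going forwards, the position does not wrap around: after a wrap it would be below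
  \<open>k\<close>, hence among the strands of \<open>B j\<close>, and the trip would turn
  back.\<close>

lemma next_A:
  assumes "1 \<le> i" "i \<le> r - 1" "k < m j" "\<not> turns_back H i (A j, k)"
    and "trip_step H i (A j, k) = (d, k')"
  shows "d = A (j + 1) \<and> k' < m (j + 1) \<and> k + shift i (j + 1) = m j + k' \<or>
    (\<exists>t<n (j + 1). d = X (j + 1) t)"
proof -
  let ?s = "shift i (j + 1)"
  have s: "0 < ?s" "?s < r" using shift_less[OF assms(1,2)] by auto
  have kr: "k < r" using assms(3) m_le_r(1)[of j] by simp
  have p: "(k + ?s) mod r = (if k + ?s < r then k + ?s else k + ?s - r)"
    by (rule add_mod_less[OF kr s(2)])
  have eq: "pos (j + 1) ((k + ?s) mod r) = (d, k')" using assms trip_step_A[of i k j] by simp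
  have nb: "d \<noteq> B j"
    using assms(4,5) by (auto simp: turns_back_def tgt_A V_not_bdry opp_A)
  have "(k + ?s) mod r < r" using kr by simp
  from eq this show ?thesis
  proof (cases rule: pos_cases)
    case B
    then show ?thesis using nb by simp
  next
    case A
    then show ?thesis using p s kr assms(3) by (auto split: if_splits)
  next
    case (X t)
    then show ?thesis by auto
  qed
qed

text \<open>Going backwards, the position has to wrap around once to continue on the square, because
  the strands of \<open>B (j + 3)\<close> come before the position of the arriving strand. This
  explains \<open>r\<close> in the equation.\<close>

lemma next_B:
  assumes "1 \<le> i" "i \<le> r - 1" "k < m j" "\<not> turns_back H i (B j, k)"
    and "trip_step H i (B j, k) = (d, k')"
  shows "d = B (j + 3) \<and> k' < m (j + 3) \<and> m (j + 3) + k + shift i j = r + k' \<or>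
    (\<exists>t<n j. d = X j t)"
proof -
  let ?s = "shift i j" and ?q = "m (j + 3) + k"
  have s: "0 < ?s" "?s < r" using shift_less[OF assms(1,2)] by auto
  have qr: "?q < r" using assms(3) m_le_r(2)[of j] by simp
  have p: "(?q + ?s) mod r = (if ?q + ?s < r then ?q + ?s else ?q + ?s - r)"
    by (rule add_mod_less[OF qr s(2)])
  have eq: "pos j ((?q + ?s) mod r) = (d, k')" using assms trip_step_B[of i k j] by simp
  have na: "d \<noteq> A j"
    using assms(4,5) by (auto simp: turns_back_def tgt_B V_not_bdry opp_B)
  have "(?q + ?s) mod r < r" using qr by simp
  from eq this show ?thesis
  proof (cases rule: pos_cases)
    case B
    then show ?thesis using p s qr assms(3) by (auto split: if_splits)
  next
    case A
    then show ?thesis using na by simp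
  next
    case (X t)
    then show ?thesis by auto
  qed
qed

text \<open>A shift strictly between 0 and \<open>r\<close> never leads back to the entering strand,
  hence \<open>u \<noteq> t\<close>.\<close>

lemma next_E:
  assumes "1 \<le> i" "i \<le> r - 1" "t < n j" "trip_step H i (E j t, 0) = (d, k')"
  shows "d = A j \<and> k' < m j \<or> d = B (j + 3) \<and> k' < m (j + 3) \<or> (\<exists>u<n j. u \<noteq> t \<and> d = X j u)"
proof -
  let ?s = "shift i j" and ?q = "m (j + 3) + m j + t"
  have s: "0 < ?s" "?s < r" using shift_less[OF assms(1,2)] by auto
  have q: "?q < r" using assms(3) degree[of j] by simp
  have p: "(?q + ?s) mod r = (if ?q + ?s < r then ?q + ?s else ?q + ?s - r)"
    by (rule add_mod_less[OF q s(2)])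
  then have "(?q + ?s) mod r \<noteq> ?q" using s q by (simp split: if_splits)
  moreover have eq: "pos j ((?q + ?s) mod r) = (d, k')" using assms trip_step_E[of i t j] by simp
  moreover have "(?q + ?s) mod r < r" using q by simp
  ultimately show ?thesis by (elim pos_cases) auto
qed

text \<open>Possible continuations after the last hourglass of the square. The empty list is among
  them because segments need not be maximal.\<close>

definition exits :: "4 \<Rightarrow> 'a list set" where
  "exits j = insert [] {[X j t] |t. t < n j}"

lemma segment_X:
  assumes "trip_segment H i P" "fst (hd P) = X j t" "t < n j"
  shows "map fst P = [X j t]"
proof (cases P)
  case (Cons s P1)
  show ?thesis
  proof (cases P1)
    case (Cons s' P2)
    then show ?thesis
      using trip_segment_Cons2(3)[of i s s' P2] assms \<open>P = s # P1\<close> L_bdry tgt_X by auto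
  qed (use Cons assms in auto)
qed (use assms in \<open>auto simp: trip_segment_def\<close>)

text \<open>Quantifying over the starting index allows the bound to be used at any corner without
  reordering the sum.\<close>

definition small_square :: bool where
  "small_square \<longleftrightarrow> (\<forall>j. m j + m (j + 1) + m (j + 2) + m (j + 3) \<le> r)"

text \<open>Lightness makes the trip leave the square, or the segment stop, after two hourglasses.
  The recorded bound is the first turn, \<open>k + shift i (j + 1) = m j + k1\<close>, combined with
  \<open>k1 < m (j + 1)\<close>.\<close>

lemma segment_A:
  assumes "1 \<le> i" "i \<le> r - 1" "small_square" "trip_segment H i P" "fst (hd P) = A j"
  shows "map fst P \<in> (#) (A j) ` exits (j + 1) \<or>
    shift i (j + 1) < m j + m (j + 1) \<and> map fst P \<in> (\<lambda>y. A j # A (j + 1) # y) ` exits (j + 2)"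
proof -
  obtain k P1 where P: "P = (A j, k) # P1"
    using assms(4,5) by (cases P) (auto simp: trip_segment_def)
  have k: "k < m j" using assms(4) P by (auto simp: trip_segment_def mult_A)
  show ?thesis
  proof (cases P1)
    case Nil
    then show ?thesis using P by (auto simp: exits_def)
  next
    case (Cons s P2)
    obtain d k1 where s: "s = (d, k1)" by (cases s)
    note c = trip_segment_Cons2[OF assms(4)[unfolded P Cons s]]
    from next_A[OF assms(1,2) k c(4) c(2)[symmetric]] show ?thesis
    proof
      assume "\<exists>t<n (j + 1). d = X (j + 1) t"
      then obtain t where t: "t < n (j + 1)" "d = X (j + 1) t" by blast
      have "map fst P1 = [X (j + 1) t]" using segment_X[of i P1 "j + 1" t] c(1) t Cons s by auto
      then show ?thesis using P t by (auto simp: exits_def)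
    next
      assume d: "d = A (j + 1) \<and> k1 < m (j + 1) \<and> k + shift i (j + 1) = m j + k1"
      show ?thesis
      proof (cases P2)
        case Nil
        then show ?thesis using P Cons s d k by (auto simp: exits_def)
      next
        case (Cons s' P3)
        obtain d' k2 where s': "s' = (d', k2)" by (cases s')
        have seg: "trip_segment H i ((A (j + 1), k1) # (d', k2) # P3)"
          using c(1) Cons s' d by simp
        note c' = trip_segment_Cons2[OF seg]
        \<comment> \<open>The equations of the two turns add up to
          \<open>k + r = m j + m (j + 1) + k2\<close>, which is impossible for
          \<open>k2 < m (j + 2)\<close> in a light square.\<close>
        have "\<not> (k1 + shift i (j + 2) = m (j + 1) + k2 \<and> k2 < m (j + 2))"
        proof
          assume "k1 + shift i (j + 2) = m (j + 1) + k2 \<and> k2 < m (j + 2)"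
          moreover have "shift i (j + 2) = r - shift i (j + 1)" "shift i (j + 1) < r"
            using shift_simps(1)[of i "j + 1"] shift_less[OF assms(1,2), of "j + 1"] assms(2) by auto
          moreover have "m j + m (j + 1) + m (j + 2) \<le> r"
            using assms(3) unfolding small_square_def by (meson add_leD1)
          ultimately show False using d by linarith
        qed
        then obtain t where t: "t < n (j + 2)" "d' = X (j + 2) t"
          using next_A[OF assms(1,2) _ c'(4) c'(2)[symmetric]] d by auto
        have "map fst P2 = [X (j + 2) t]" using segment_X[of i P2 "j + 2" t] c'(1) t Cons s' by auto
        then show ?thesis using P \<open>P1 = s # P2\<close> s d k t by (auto simp: exits_def)
      qed
    qed
  qed
qed

text \<open>Because the first turn wraps around, \<open>k < m j\<close> gives a lower bound on the
  shift, where the forward direction has an upper one.\<close>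

lemma segment_B:
  assumes "1 \<le> i" "i \<le> r - 1" "small_square" "trip_segment H i P" "fst (hd P) = B j"
  shows "map fst P \<in> (#) (B j) ` exits j \<or>
    r < m (j + 3) + m j + shift i j \<and> map fst P \<in> (\<lambda>y. B j # B (j + 3) # y) ` exits (j + 3)"
proof -
  obtain k P1 where P: "P = (B j, k) # P1"
    using assms(4,5) by (cases P) (auto simp: trip_segment_def)
  have k: "k < m j" using assms(4) P by (auto simp: trip_segment_def mult_B)
  show ?thesis
  proof (cases P1)
    case Nil
    then show ?thesis using P by (auto simp: exits_def)
  next
    case (Cons s P2)
    obtain d k1 where s: "s = (d, k1)" by (cases s)
    note c = trip_segment_Cons2[OF assms(4)[unfolded P Cons s]]
    from next_B[OF assms(1,2) k c(4) c(2)[symmetric]] show ?thesis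
    proof
      assume "\<exists>t<n j. d = X j t"
      then obtain t where t: "t < n j" "d = X j t" by blast
      have "map fst P1 = [X j t]" using segment_X[of i P1 j t] c(1) t Cons s by auto
      then show ?thesis using P t by (auto simp: exits_def)
    next
      assume d: "d = B (j + 3) \<and> k1 < m (j + 3) \<and> m (j + 3) + k + shift i j = r + k1"
      show ?thesis
      proof (cases P2)
        case Nil
        then show ?thesis using P Cons s d k by (auto simp: exits_def)
      next
        case (Cons s' P3)
        obtain d' k2 where s': "s' = (d', k2)" by (cases s')
        have seg: "trip_segment H i ((B (j + 3), k1) # (d', k2) # P3)"
          using c(1) Cons s' d by simp
        note c' = trip_segment_Cons2[OF seg]
        \<comment> \<open>The two turns add up to \<open>m (j + 2) + m (j + 3) + k = r + k2\<close>,
          which is impossible for \<open>k < m j\<close> in a light square.\<close>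
        have "\<not> (m (j + 2) + k1 + shift i (j + 3) = r + k2)"
        proof
          assume "m (j + 2) + k1 + shift i (j + 3) = r + k2"
          moreover have "shift i (j + 3) = r - shift i j" "shift i j < r"
            using shift_simps(3)[of i j] shift_less[OF assms(1,2), of j] assms(2) by auto
          moreover have "m j + m (j + 2) + m (j + 3) \<le> r"
            using assms(3)[unfolded small_square_def, rule_format, of j] by linarith
          ultimately show False using d k by linarith
        qed
        then obtain t where t: "t < n (j + 3)" "d' = X (j + 3) t"
          using next_B[OF assms(1,2) _ c'(4) c'(2)[symmetric]] d by auto
        have "map fst P2 = [X (j + 3) t]" using segment_X[of i P2 "j + 3" t] c'(1) t Cons s' by auto
        then show ?thesis using P \<open>P1 = s # P2\<close> s d k t by (auto simp: exits_def)
      qed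
    qed
  qed
qed

text \<open>\<open>trivial\<close> stands for segments that use no hourglass of the square. The
  indices of \<open>BB\<close> are arranged so that \<open>AA\<close> and \<open>BB\<close> with the
  same \<open>j\<close> use the same hourglasses \<open>j\<close> and \<open>j + 1\<close>, with
  common corner \<open>j + 1\<close>.\<close>

lemma segment_cases:
  assumes "1 \<le> i" "i \<le> r - 1" "small_square" "trip_segment H i P"
  obtains (trivial) j t where "t < n j"
      "map fst P = [E j t] \<or> map fst P = [X j t] \<or> (\<exists>u<n j. u \<noteq> t \<and> map fst P = [E j t, X j u])"
  | (A) j x y where "x = [] \<or> (\<exists>t<n j. x = [E j t])" "y \<in> exits (j + 1)" "map fst P = x @ A j # y"
  | (AA) j x y where "x = [] \<or> (\<exists>t<n j. x = [E j t])" "y \<in> exits (j + 2)"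
      "map fst P = x @ A j # A (j + 1) # y" "shift i (j + 1) < m j + m (j + 1)"
  | (B) j x y where "x = [] \<or> (\<exists>t<n (j + 1). x = [E (j + 1) t])" "y \<in> exits j"
      "map fst P = x @ B j # y"
  | (BB) j x y where "x = [] \<or> (\<exists>t<n (j + 2). x = [E (j + 2) t])" "y \<in> exits j"
      "map fst P = x @ B (j + 1) # B j # y" "r < m j + m (j + 1) + shift i (j + 1)"
proof -
  obtain d k P1 where P: "P = (d, k) # P1"
    using assms(4) by (cases P) (auto simp: trip_segment_def)
  have "(d, k) \<in> strands" using trip_segment_strands[OF assms(4)] P by auto
  then have "d \<in> darts H" "k < mult H d" by (auto simp: strands_def)
  then show thesis
  proof (cases rule: darts_cases)
    case d: (A j)
    have hd: "fst (hd P) = A j" using P d by simp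
    have x: "[] = [] \<or> (\<exists>t<n j. [] = [E j t])" by simp
    from segment_A[OF assms hd] show thesis
    proof (elim disjE conjE imageE)
      fix y assume "map fst P = A j # y" "y \<in> exits (j + 1)"
      then show thesis by (intro A[OF x]) simp_all
    next
      fix y assume "map fst P = A j # A (j + 1) # y" "y \<in> exits (j + 2)"
        "shift i (j + 1) < m j + m (j + 1)"
      then show thesis by (intro AA[OF x]) simp_all
    qed
  next
    case d: (B j)
    have hd: "fst (hd P) = B j" using P d by simp
    have x: "[] = [] \<or> (\<exists>t<n j'. [] = [E j' t])" for j' by simp
    from segment_B[OF assms hd] show thesis
    proof (elim disjE conjE imageE)
      fix y assume "map fst P = B j # y" "y \<in> exits j"
      then show thesis by (intro B[OF x]) simp_all
    next
      fix y assume "map fst P = B j # B (j + 3) # y" "y \<in> exits (j + 3)"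
        "r < m (j + 3) + m j + shift i j"
      then show thesis by (intro BB[OF x, of _ "j + 3"]) simp_all
    qed
  next
    case (X j t)
    then show thesis using segment_X[OF assms(4), of j t] P by (intro trivial[of t j]) simp_all
  next
    case E: (E j t)
    have k: "k = 0" using \<open>k < mult H d\<close> E by (simp add: mult_E)
    show thesis
    proof (cases P1)
      case Nil
      then show thesis using P E by (intro trivial[of t j]) simp_all
    next
      case (Cons s P2)
      obtain d' k' where s: "s = (d', k')" by (cases s)
      note c = trip_segment_Cons2[OF assms(4)[unfolded P Cons s]]
      have seg: "trip_segment H i P1" using c(1) Cons s by simp
      have x: "[E j t] = [] \<or> (\<exists>t'<n j. [E j t] = [E j t'])" using E by auto
      have "trip_step H i (E j t, 0) = (d', k')" using c(2) E k by simp
      from next_E[OF assms(1,2) \<open>t < n j\<close> this]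
      consider "d' = A j" | "d' = B (j + 3)" | u where "u < n j" "u \<noteq> t" "d' = X j u" by blast
      then show thesis
      proof cases
        case 1
        have hd: "fst (hd P1) = A j" using Cons s 1 by simp
        from segment_A[OF assms(1-3) seg hd] show thesis
        proof (elim disjE conjE imageE)
          fix y assume "map fst P1 = A j # y" "y \<in> exits (j + 1)"
          then show thesis using P E by (intro A[OF x]) simp_all
        next
          fix y assume "map fst P1 = A j # A (j + 1) # y" "y \<in> exits (j + 2)"
            "shift i (j + 1) < m j + m (j + 1)"
          then show thesis using P E by (intro AA[OF x]) simp_all
        qed
      next
        case 2
        have hd: "fst (hd P1) = B (j + 3)" using Cons s 2 by simp
        have x': "[E j t] = [] \<or> (\<exists>t'<n (j + 3 + 1). [E j t] = [E (j + 3 + 1) t'])"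
          "[E j t] = [] \<or> (\<exists>t'<n (j + 2 + 2). [E j t] = [E (j + 2 + 2) t'])"
          using x by simp_all
        from segment_B[OF assms(1-3) seg hd] show thesis
        proof (elim disjE conjE imageE)
          fix y assume "map fst P1 = B (j + 3) # y" "y \<in> exits (j + 3)"
          then show thesis using P E by (intro B[OF x'(1)]) simp_all
        next
          fix y assume "map fst P1 = B (j + 3) # B (j + 3 + 3) # y" "y \<in> exits (j + 3 + 3)"
            "r < m (j + 3 + 3) + m (j + 3) + shift i (j + 3)"
          then show thesis using P E by (intro BB[OF x'(2)]) simp_all
        qed
      next
        case 3
        then have "map fst P1 = [X j u]" using segment_X[OF seg, of j u] Cons s by simp
        then show thesis using P E 3 by (intro trivial[of t j]) auto
      qed
    qed
  qed
qed

lemma exits_Cons: "y \<in> exits j \<Longrightarrow> y = [] \<or> (\<exists>t<n j. y = [X j t])"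
  by (auto simp: exits_def)

lemma visits_map: "P \<noteq> [] \<Longrightarrow> visits H P = src H (hd (map fst P)) # map (tgt H) (map fst P)"
  by (simp add: visits_def hd_map)

lemma distinct_visits:
  assumes "1 \<le> i" "i \<le> r - 1" "small_square" "trip_segment H i P"
  shows "distinct (visits H P)"
proof -
  have "P \<noteq> []" using assms(4) by (simp add: trip_segment_def)
  note v = visits_map[OF this]
  from assms show ?thesis
  proof (cases rule: segment_cases)
    case (trivial j t)
    then show ?thesis
      unfolding v by (auto simp: ends V_neq_L V_neq_L' L_eq)
  next
    case (A j x y)
    then show ?thesis
      unfolding v by (auto dest!: exits_Cons simp: ends V_eq V_neq_L V_neq_L' L_eq)
  next
    case (AA j x y)
    then show ?thesis
      unfolding v by (auto dest!: exits_Cons simp: ends V_eq V_neq_L V_neq_L' L_eq)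
  next
    case (B j x y)
    then show ?thesis
      unfolding v by (auto dest!: exits_Cons simp: ends V_eq V_neq_L V_neq_L' L_eq)
  next
    case (BB j x y)
    then show ?thesis
      unfolding v by (auto dest!: exits_Cons simp: ends V_eq V_neq_L V_neq_L' L_eq)
  qed
qed

text \<open>Extracts from the shapes what the double crossings depend on: the sense of rotation, the
  two hourglasses that are available, and the bound on the shift if both are used.\<close>

lemma segment_sides:
  assumes "1 \<le> i" "i \<le> r - 1" "small_square" "trip_segment H i P"
  obtains (forward) f where "\<And>j. A j \<in> fst ` set P \<Longrightarrow> j = f \<or> j = f + 1"
      "\<And>j. B j \<notin> fst ` set P"
      "A f \<in> fst ` set P \<Longrightarrow> A (f + 1) \<in> fst ` set P \<Longrightarrow> shift i (f + 1) < m f + m (f + 1)"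
  | (backward) f where "\<And>j. B j \<in> fst ` set P \<Longrightarrow> j = f \<or> j = f + 1"
      "\<And>j. A j \<notin> fst ` set P"
      "B f \<in> fst ` set P \<Longrightarrow> B (f + 1) \<in> fst ` set P \<Longrightarrow> r < m f + m (f + 1) + shift i (f + 1)"
proof -
  have D: "fst ` set P = set (map fst P)" by simp
  from assms show thesis
  proof (cases rule: segment_cases)
    case (trivial j t)
    \<comment> \<open>Vacuous: no hourglass of the square is used, so the direction and the index 0
      are arbitrary.\<close>
    then show thesis by (intro forward[of 0]; unfold D) (auto simp: dart_eqs)
  next
    case (A j x y)
    then show thesis
      by (intro forward[of j]; unfold D) (auto dest!: exits_Cons simp: dart_eqs)
  next
    case (AA j x y)
    then show thesis
      by (intro forward[of j]; unfold D) (auto dest!: exits_Cons simp: dart_eqs)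
  next
    case (B j x y)
    then show thesis
      by (intro backward[of j]; unfold D) (auto dest!: exits_Cons simp: dart_eqs)
  next
    case (BB j x y)
    then show thesis
      by (intro backward[of j]; unfold D) (auto dest!: exits_Cons simp: dart_eqs)
  qed
qed

definition side :: "4 set \<Rightarrow> 'v \<Rightarrow> bool" where
  "side J v \<longleftrightarrow> (\<exists>j\<in>J. v = V j \<or> (\<exists>t<n j. v = L j t))"

text \<open>Boundary vertices are put on the side of their corner, so only hourglasses of the square
  can cross the cut.\<close>

lemma side_simps: "side J (V j) \<longleftrightarrow> j \<in> J" "t < n j \<Longrightarrow> side J (L j t) \<longleftrightarrow> j \<in> J"
  by (auto simp: side_def V_eq V_neq_L V_neq_L' L_eq)

text \<open>Read g as a cut that contains the edge of d and otherwise only edges used by neither P nor Q: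
  between its two intersections with Q, the segment P changes sides and Q does not.\<close>

lemma no_separating_edge:
  fixes g :: "'v \<Rightarrow> bool"
  assumes P: "trip_segment H i P" "distinct (visits H P)" and Q: "trip_segment H i' Q"
    and S: "S = common_darts H P Q"
    and p: "p = take a (drop b (contracted_walk S P))" "d \<in> set p"
    and q: "q = take a' (drop b' (contracted_walk S Q))" "q \<noteq> []"
    and g: "\<And>x. x \<in> fst ` set P \<union> fst ` set Q \<union> S \<Longrightarrow> x \<noteq> d \<Longrightarrow> x \<noteq> opp H d \<Longrightarrow>
      g (src H x) = g (tgt H x)"
    and gd: "g (src H d) \<noteq> g (tgt H d)"
    and pieces: "\<And>g :: 'v \<Rightarrow> bool. (\<And>d. d \<in> S \<Longrightarrow> g (src H d) = g (tgt H d)) \<Longrightarrow>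
       successively (\<lambda>x y. g (tgt H x) = g (src H y)) p \<and>
       successively (\<lambda>x y. g (tgt H x) = g (src H y)) q \<and>
       g (src H (hd p)) = g (src H (hd q)) \<and> g (tgt H (last p)) = g (tgt H (last q))"
  shows False
proof -
  have sub: "set (take a (drop b xs)) \<subseteq> set xs" for a b and xs :: "'a list"
    by (meson set_drop_subset set_take_subset subset_trans)
  have pP: "set p \<subseteq> fst ` set P - S" "set q \<subseteq> fst ` set Q - S"
    using sub[of a b "contracted_walk S P"] sub[of a' b' "contracted_walk S Q"]
    unfolding p(1) q(1) by (auto simp: contracted_walk_def)
  have dP: "d \<in> fst ` set P" "d \<notin> S" using p(2) pP by auto
  have dd: "d \<in> darts H" using dP(1) trip_segment_strands[OF P(1)] by (auto simp: strands_def)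
  have dQ: "d \<notin> fst ` set Q" "opp H d \<notin> fst ` set Q"
    using dP unfolding S common_darts_def by auto
  have oS: "opp H d \<notin> S"
    using dP(2) opp_opp[OF dd] unfolding S common_darts_def by auto
  note dist = distinct_visits_edges[OF rotation_system_axioms P]
  have distp: "distinct p"
    using dist(1) by (simp add: p(1) contracted_walk_def)
  have gS: "g (src H x) = g (tgt H x)" if "x \<in> S" for x
    using g[of x] that dP(2) oS by auto
  note pc = pieces[of g, OF gS]
  \<comment> \<open>A segment that visits no vertex twice does not traverse the edge of
    \<open>d\<close> backwards, so \<open>opp H d\<close> is not in \<open>p\<close>.\<close>
  have gp: "g (src H x) = g (tgt H x)" if "x \<in> set p" "x \<noteq> d" for x
    using g[of x] that pP dist(2)[OF dP(1)] by auto
  have gq: "g (src H x) = g (tgt H x)" if "x \<in> set q" for x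
    using g[of x] that pP dQ by auto
  have "g (src H (hd p)) = g (src H d)" "g (tgt H (last p)) = g (tgt H d)"
    using successively_one_change[of g "tgt H" "src H" p d] pc p(2) distp gp by auto
  moreover have "g (src H (hd q)) = g (tgt H (last q))"
    using successively_no_change[of g "tgt H" "src H" q] pc q(2) gq by auto
  ultimately show False using gd pc by auto
qed

text \<open>Two kinds of cuts contradict \<open>no_separating_edge\<close>. A boundary edge is cut
  off by isolating its boundary vertex; an hourglass of the square is separated by cutting the
  square there and at an hourglass that neither segment uses.\<close>

lemma edge_forces_all:
  assumes P: "trip_segment H i P" "distinct (visits H P)" and Q: "trip_segment H i' Q"
    and S: "S = common_darts H P Q"
    and p: "p = take a (drop b (contracted_walk S P))" "d \<in> set p"
    and q: "q = take a' (drop b' (contracted_walk S Q))" "q \<noteq> []"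
    and pieces: "\<And>g :: 'v \<Rightarrow> bool. (\<And>d. d \<in> S \<Longrightarrow> g (src H d) = g (tgt H d)) \<Longrightarrow>
       successively (\<lambda>x y. g (tgt H x) = g (src H y)) p \<and>
       successively (\<lambda>x y. g (tgt H x) = g (src H y)) q \<and>
       g (src H (hd p)) = g (src H (hd q)) \<and> g (tgt H (last p)) = g (tgt H (last q))"
  shows "\<exists>j. d = A j \<or> d = B j"
    and "A j \<in> fst ` set P \<union> fst ` set Q \<or> B j \<in> fst ` set P \<union> fst ` set Q"
proof -
  note sep = no_separating_edge[OF P Q S p q _ _ pieces]
  have "set p \<subseteq> fst ` set P"
    unfolding p(1) contracted_walk_def by (auto dest!: in_set_takeD in_set_dropD)
  then have dP: "d \<in> fst ` set P" using p(2) by auto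
  have PQ: "x \<in> darts H" if "x \<in> fst ` set P \<union> fst ` set Q \<union> S" for x
    using that common_darts_darts[OF P(1), of Q] trip_segment_strands[OF P(1)]
      trip_segment_strands[OF Q] by (auto simp: S strands_def)
  have dd: "d \<in> darts H" using PQ dP by auto
  show edge: "\<exists>j. d = A j \<or> d = B j"
  proof (rule ccontr)
    assume "\<nexists>j. d = A j \<or> d = B j"
    then obtain k t where t: "t < n k" "d = X k t \<or> d = E k t"
      using dd by (auto elim!: darts_cases)
    show False
    proof (rule sep[of "\<lambda>v. v = L k t"])
      fix x assume x: "x \<in> fst ` set P \<union> fst ` set Q \<union> S" "x \<noteq> d" "x \<noteq> opp H d"
      show "(src H x = L k t) = (tgt H x = L k t)"
        using PQ[OF x(1)] x t
        by (cases rule: darts_cases) (auto simp: ends V_neq_L L_eq opp_X opp_E)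
    next
      show "(src H d = L k t) \<noteq> (tgt H d = L k t)"
        using t by (auto simp: ends V_neq_L)
    qed
  qed
  show "A j \<in> fst ` set P \<union> fst ` set Q \<or> B j \<in> fst ` set P \<union> fst ` set Q"
  proof (rule ccontr)
    assume not: "\<not> ?thesis"
    obtain f where f: "d = A f \<or> d = B f" using edge by auto
    then have "f \<noteq> j" using not dP by (metis UnI1)
    then obtain J where J: "\<And>x. ((x \<in> J) = (x + 1 \<in> J)) \<longleftrightarrow> x \<noteq> f \<and> x \<noteq> j"
      by (rule cyclic_cut) blast
    have notS: "A j \<notin> S" "B j \<notin> S"
      using not by (auto simp: S common_darts_def opp_A opp_B)
    show False
    proof (rule sep[of "side J"])
      fix x assume x: "x \<in> fst ` set P \<union> fst ` set Q \<union> S" "x \<noteq> d" "x \<noteq> opp H d"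
      show "side J (src H x) = side J (tgt H x)"
        using PQ[OF x(1)]
      proof (cases rule: darts_cases)
        case (A k)
        then have "k \<noteq> f" "k \<noteq> j" using x f not notS by (auto simp: opp_A opp_B)
        then show ?thesis using A J[of k] by (simp add: ends side_simps)
      next
        case (B k)
        then have "k \<noteq> f" "k \<noteq> j" using x f not notS by (auto simp: opp_A opp_B)
        then show ?thesis using B J[of k] by (auto simp: ends side_simps)
      qed (simp_all add: ends side_simps)
    next
      show "side J (src H d) \<noteq> side J (tgt H d)"
        using f J[of f] by (auto simp: ends side_simps)
    qed
  qed
qed

lemma no_oriented_double_crossing:
  assumes "small_square" and i: "1 \<le> i" "i \<le> r - 1" "1 \<le> i'" "i' \<le> r - 1" "i' = i \<or> i' = i + 1"
    and P: "trip_segment H i P" and Q: "trip_segment H i' Q"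
  shows "\<not> oriented_double_crossing H P Q"
proof
  assume "oriented_double_crossing H P Q"
  define S where "S = common_darts H P Q"
  show False
  proof (rule oriented_double_crossing_pieces[OF P Q \<open>oriented_double_crossing H P Q\<close>, folded S_def])
    fix p b a q b' a'
    assume p: "p = take a (drop b (contracted_walk S P))" "p \<noteq> []"
      and q: "q = take a' (drop b' (contracted_walk S Q))" "q \<noteq> []"
      and pieces: "\<And>g :: 'v \<Rightarrow> bool. (\<And>d. d \<in> S \<Longrightarrow> g (src H d) = g (tgt H d)) \<Longrightarrow>
         successively (\<lambda>x y. g (tgt H x) = g (src H y)) p \<and>
         successively (\<lambda>x y. g (tgt H x) = g (src H y)) q \<and>
         g (src H (hd p)) = g (src H (hd q)) \<and> g (tgt H (last p)) = g (tgt H (last q))"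
    \<comment> \<open>The roles are exchanged so that the arcs of \<open>q\<close> are covered as
      well.\<close>
    have S': "S = common_darts H Q P" by (auto simp: S_def common_darts_def)
    have pieces': "\<And>g :: 'v \<Rightarrow> bool. (\<And>d. d \<in> S \<Longrightarrow> g (src H d) = g (tgt H d)) \<Longrightarrow>
         successively (\<lambda>x y. g (tgt H x) = g (src H y)) q \<and>
         successively (\<lambda>x y. g (tgt H x) = g (src H y)) p \<and>
         g (src H (hd q)) = g (src H (hd p)) \<and> g (tgt H (last q)) = g (tgt H (last p))"
      using pieces by metis
    define DP DQ where "DP = fst ` set P" and "DQ = fst ` set Q"
    have vP: "distinct (visits H P)" and vQ: "distinct (visits H Q)"
      using distinct_visits assms by auto
    note forceP = edge_forces_all[OF P vP Q S_def p(1) _ q pieces]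
    note forceQ = edge_forces_all[OF Q vQ P S' q(1) _ p pieces']
    have all: "A j \<in> DP \<or> B j \<in> DP \<or> A j \<in> DQ \<or> B j \<in> DQ" for j
      using forceP(2)[of "hd p" j] p(2) unfolding DP_def DQ_def by auto
    have sub: "set (take a (drop b (contracted_walk S R))) \<subseteq> fst ` set R" for a b R
      unfolding contracted_walk_def by (auto dest!: in_set_takeD in_set_dropD)
    have hp: "hd p \<in> DP" "\<exists>j. hd p = A j \<or> hd p = B j"
      using forceP(1)[of "hd p"] hd_in_set[OF p(2)] sub[of a b P] unfolding DP_def p(1)[symmetric]
      by auto
    have hq: "hd q \<in> DQ" "\<exists>j. hd q = A j \<or> hd q = B j"
      using forceQ(1)[of "hd q"] hd_in_set[OF q(2)] sub[of a' b' Q] unfolding DQ_def q(1)[symmetric]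
      by auto
    \<comment> \<open>If no hourglass is shared, the contracted arcs all belong to boundary edges,
      which no cut of the form \<open>side J\<close> crosses.\<close>
    have disjoint: "side J (src H (hd p)) = side J (src H (hd q))"
      if none: "\<And>j. \<not> ((A j \<in> DP \<or> B j \<in> DP) \<and> (A j \<in> DQ \<or> B j \<in> DQ))" for J
    proof -
      have "side J (src H x) = side J (tgt H x)" if "x \<in> S" for x
      proof -
        have "x \<in> darts H" using that common_darts_darts[OF P] S_def by auto
        then show ?thesis
        proof (cases rule: darts_cases)
          case (A j)
          then show ?thesis using \<open>x \<in> S\<close> none[of j]
            by (auto simp: S_def common_darts_def opp_A DP_def DQ_def)
        next
          case (B j)
          then show ?thesis using \<open>x \<in> S\<close> none[of j]
            by (auto simp: S_def common_darts_def opp_B DP_def DQ_def)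
        qed (simp_all add: ends side_simps)
      qed
      then show ?thesis using pieces by blast
    qed
    have sh: "shift i' j \<le> shift i j + 1" "shift i j \<le> shift i' j + 1" for j
      using i by (auto simp: shift_def)
    have total: "m f + m (f + 1) + m (f + 2) + m (f + 3) \<le> r" for f
      using assms(1) by (simp add: small_square_def)
    have le: "i \<le> r" "i' \<le> r" using i by auto
    \<comment> \<open>Both bounds are strict and opposite corners have equal shifts, so the shift of
      the backward segment would exceed that of the forward one by at least 2.\<close>
    have opposite: False
      if "shift i (f + 1) < m f + m (f + 1)" "r < m (f + 2) + m (f + 3) + shift i' (f + 3)" for f
      using that sh[of "f + 1"] total[of f] shift_simps(2)[OF le(2), of "f + 1"] by simp
    have opposite': False
      if "shift i' (f + 1) < m f + m (f + 1)" "r < m (f + 2) + m (f + 3) + shift i (f + 3)" for f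
      using that sh[of "f + 1"] total[of f] shift_simps(2)[OF le(1), of "f + 1"] by simp
    \<comment> \<open>The hourglasses \<open>f + 2\<close> and \<open>f + 3\<close>, which the first
      segment cannot use, have to be the two available to the second.\<close>
    have covered: "f' = f + 2" if "f + 2 = f' \<or> f + 2 = f' + 1" "f + 3 = f' \<or> f + 3 = f' + 1" for f f' :: 4
    proof -
      consider "f' = f" | "f' = f + 1" | "f' = f + 2" | "f' = f + 3"
        using exhaust_index4[of f' f] by blast
      then show ?thesis using that by cases simp_all
    qed
    from i(1,2) assms(1) P show False
    proof (cases rule: segment_sides)
      case P: (forward f)
      from i(3,4) assms(1) Q show False
      proof (cases rule: segment_sides)
        case Q: (forward f')
        note all' = all and P' = P(1,2)[folded DP_def] and Q' = Q(1,2)[folded DQ_def]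
        have f': "f' = f + 2"
          using covered[of f f'] all'[of "f + 2"] all'[of "f + 3"] P'(1)[of "f + 2"] P'(1)[of "f + 3"]
            P'(2) Q'(1)[of "f + 2"] Q'(1)[of "f + 3"] Q'(2) by auto
        have "\<not> ((A j \<in> DP \<or> B j \<in> DP) \<and> (A j \<in> DQ \<or> B j \<in> DQ))" for j
          using P' Q' f' by force
        \<comment> \<open>Forward arcs \<open>A j\<close> start at \<open>V j\<close>. Two forward
          pieces on disjoint halves thus leave their first intersection from different sides of a
          cut that no contracted arc crosses.\<close>
        then have "side {f, f + 1} (src H (hd p)) = side {f, f + 1} (src H (hd q))"
          by (rule disjoint)
        moreover have "side {f, f + 1} (src H (hd p))"
          using hp P'(2) by (auto simp: ends side_simps dest!: P'(1))
        moreover have "\<not> side {f, f + 1} (src H (hd q))"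
          using hq f' Q'(2) by (auto simp: ends side_simps dest!: Q'(1))
        ultimately show False by simp
      next
        case Q: (backward f')
        note all' = all and P' = P(1,2)[folded DP_def] and Q' = Q(1,2)[folded DQ_def]
        have f': "f' = f + 2"
          using covered[of f f'] all'[of "f + 2"] all'[of "f + 3"] P'(1)[of "f + 2"] P'(1)[of "f + 3"]
            P'(2) Q'(1)[of "f + 2"] Q'(1)[of "f + 3"] Q'(2) by auto
        have "A f \<in> DP" "A (f + 1) \<in> DP"
          "B f' \<in> DQ" "B (f' + 1) \<in> DQ"
          using all'[of f] all'[of "f + 1"] all'[of "f + 2"] all'[of "f + 3"] P'(2) Q'(2)
            P'(1)[of "f + 2"] P'(1)[of "f + 3"] Q'(1)[of f] Q'(1)[of "f + 1"] f' by auto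
        then show False using opposite[of f] P(3) Q(3) f' unfolding DP_def DQ_def by simp
      qed
    next
      case P: (backward f)
      from i(3,4) assms(1) Q show False
      proof (cases rule: segment_sides)
        case Q: (forward f')
        note all' = all and P' = P(1,2)[folded DP_def] and Q' = Q(1,2)[folded DQ_def]
        have f': "f' = f + 2"
          using covered[of f f'] all'[of "f + 2"] all'[of "f + 3"] P'(1)[of "f + 2"] P'(1)[of "f + 3"]
            P'(2) Q'(1)[of "f + 2"] Q'(1)[of "f + 3"] Q'(2) by auto
        have "B f \<in> DP" "B (f + 1) \<in> DP"
          "A f' \<in> DQ" "A (f' + 1) \<in> DQ"
          using all'[of f] all'[of "f + 1"] all'[of "f + 2"] all'[of "f + 3"] P'(2) Q'(2)
            P'(1)[of "f + 2"] P'(1)[of "f + 3"] Q'(1)[of f] Q'(1)[of "f + 1"] f' by auto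
        then show False using opposite'[of "f + 2"] P(3) Q(3) f' unfolding DP_def DQ_def by simp
      next
        case Q: (backward f')
        note all' = all and P' = P(1,2)[folded DP_def] and Q' = Q(1,2)[folded DQ_def]
        have f': "f' = f + 2"
          using covered[of f f'] all'[of "f + 2"] all'[of "f + 3"] P'(1)[of "f + 2"] P'(1)[of "f + 3"]
            P'(2) Q'(1)[of "f + 2"] Q'(1)[of "f + 3"] Q'(2) by auto
        have "\<not> ((A j \<in> DP \<or> B j \<in> DP) \<and> (A j \<in> DQ \<or> B j \<in> DQ))" for j
          using P' Q' f' by force
        \<comment> \<open>Backward arcs \<open>B j\<close> start at \<open>V (j + 1)\<close>, which
          moves the cut by one corner.\<close>
        then have "side {f + 1, f + 2} (src H (hd p)) = side {f + 1, f + 2} (src H (hd q))"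
          by (rule disjoint)
        moreover have "side {f + 1, f + 2} (src H (hd p))"
          using hp P'(2) by (auto simp: ends side_simps dest!: P'(1))
        moreover have "\<not> side {f + 1, f + 2} (src H (hd q))"
          using hq f' Q'(2) by (auto simp: ends side_simps dest!: Q'(1))
        ultimately show False by simp
      qed
    qed
  qed
qed

section \<open>Connectivity, and the conclusion for light squares\<close>

lemma V_reachable: "V j \<rightarrow>\<^sup>*\<^bsub>base H\<^esub> V j'"
proof -
  interpret wf_digraph "base H"
    by unfold_locales (auto elim!: darts_cases simp: ends verts_eq)
  have step: "V j \<rightarrow>\<^bsub>base H\<^esub> V (j + 1)" for j
    using in_arcs_imp_in_arcs_ends[of "A j"] in_darts by (simp add: ends arc_to_ends_def)
  have 1: "V j \<rightarrow>\<^sup>*\<^bsub>base H\<^esub> V (j + 1)" for j using step by blast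
  have 2: "V j \<rightarrow>\<^sup>*\<^bsub>base H\<^esub> V (j + 2)" for j
    using reachable_trans[OF 1[of j] 1[of "j + 1"]] by simp
  have 3: "V j \<rightarrow>\<^sup>*\<^bsub>base H\<^esub> V (j + 3)" for j
    using reachable_trans[OF 2[of j] 1[of "j + 2"]] by simp
  show ?thesis
    using exhaust_index4[of j' j] 1 2 3 by (auto simp: verts_eq)
qed

lemma no_isolated_components_if_exit:
  assumes t: "t < n j"
  shows "no_isolated_components H"
proof -
  interpret wf_digraph "base H"
    by unfold_locales (auto elim!: darts_cases simp: ends verts_eq)
  have adj: "src H d \<rightarrow>\<^sup>*\<^bsub>base H\<^esub> tgt H d" if "d \<in> darts H" for d
    using in_arcs_imp_in_arcs_ends[OF that] by (auto simp: arc_to_ends_def)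
  have both: "v \<rightarrow>\<^sup>*\<^bsub>base H\<^esub> V j \<and> V j \<rightarrow>\<^sup>*\<^bsub>base H\<^esub> v" if v: "v \<in> verts (base H)" for v
  proof -
    consider k where "v = V k" | k u where "u < n k" "v = L k u" using v by (auto simp: verts_eq)
    then show ?thesis
    proof cases
      case 2
      have "L k u \<rightarrow>\<^sup>*\<^bsub>base H\<^esub> V k" "V k \<rightarrow>\<^sup>*\<^bsub>base H\<^esub> L k u"
        using adj[of "E k u"] adj[of "X k u"] 2(1) in_darts by (simp_all add: ends)
      then show ?thesis using 2 V_reachable reachable_trans by blast
    qed (use V_reachable in blast)
  qed
  have "\<not> isolated_component H C" for C
  proof
    assume "isolated_component H C"
    then have C: "C \<noteq> {}" "\<And>u v. u \<in> C \<Longrightarrow> v \<in> C \<Longrightarrow> u \<rightarrow>\<^sup>*\<^bsub>base H\<^esub> v"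
      "\<And>u v. u \<in> C \<Longrightarrow> v \<notin> C \<Longrightarrow> \<not> u \<rightarrow>\<^sup>*\<^bsub>base H\<^esub> v \<or> \<not> v \<rightarrow>\<^sup>*\<^bsub>base H\<^esub> u"
      "C \<inter> set (bdry H) = {}"
      by (auto simp: isolated_component_def sccs_verts_def)
    obtain u where u: "u \<in> C" using C(1) by auto
    then have "u \<in> verts (base H)" using C(2)[of u u] reachable_in_verts by blast
    then have "u \<rightarrow>\<^sup>*\<^bsub>base H\<^esub> L j t" "L j t \<rightarrow>\<^sup>*\<^bsub>base H\<^esub> u"
      using both[of u] both[of "L j t"] t reachable_trans by (auto simp: verts_eq)
    then have "L j t \<in> C" using C(3)[OF u] by blast
    then show False using C(4) L_bdry[OF t] by auto
  qed
  then show ?thesis by (simp add: no_isolated_components_def)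
qed

lemma fully_reduced_if_small:
  assumes "small_square"
  shows "fully_reduced r H"
proof -
  \<comment> \<open>Without exits the whole square would be isolated. In that case adjacent
    multiplicities would add up to \<open>r\<close>, so two disjoint pairs would give the total
    \<open>2 * r\<close>.\<close>
  have "\<exists>j. 0 < n j"
  proof (rule ccontr)
    assume "\<nexists>j. 0 < n j"
    then have "n j = 0" for j by simp
    then have "m j + m (j + 1) = r" for j using m_degree[of j] by simp
    from this[of 0] this[of 2] have "2 * r \<le> r"
      using assms[unfolded small_square_def, rule_format, of 0] by simp
    then show False using m_pos[of 0] m_le_r(1)[of 0] by simp
  qed
  then have "no_isolated_components H" using no_isolated_components_if_exit by blast
  moreover have "\<not> oriented_double_crossing H P Q"
    if "1 \<le> i \<and> i \<le> r - 1 \<and> trip_segment H i P \<and> trip_segment H i Q \<and> P \<noteq> Q" for i P Q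
    using no_oriented_double_crossing[OF assms, of i i P Q] that by simp
  moreover have "\<not> oriented_double_crossing H P Q"
    if "1 \<le> i \<and> i + 1 \<le> r - 1 \<and> trip_segment H i P \<and> trip_segment H (i + 1) Q" for i P Q
    using no_oriented_double_crossing[OF assms, of i "i + 1" P Q] that by simp
  ultimately show ?thesis
    using distinct_visits[OF _ _ assms] unfolding fully_reduced_def by blast
qed

end

subsection \<open>Heavy squares are not fully reduced\<close>

lemma between_cycle:
  assumes cyc: "\<And>i. i < N \<Longrightarrow> \<pi> (h i) = h (Suc i mod N)" and inj: "inj_on h {..<N}"
    and "x < N" "y < N" "0 < t" "t < N" "\<And>u. 0 < u \<Longrightarrow> u \<le> t \<Longrightarrow> (x + u) mod N \<noteq> y"
  shows "h ((x + t) mod N) \<in> between \<pi> (h x) (h y)"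
proof -
  have pow: "(\<pi> ^^ u) (h x) = h ((x + u) mod N)" for u
    by (rule funpow_mod_add[of N \<pi> h, OF cyc \<open>x < N\<close>])
  have "(\<pi> ^^ u) (h x) \<noteq> h x \<and> (\<pi> ^^ u) (h x) \<noteq> h y" if u: "0 < u" "u \<le> t" for u
  proof -
    have "(x + u) mod N = (if x + u < N then x + u else x + u - N)"
      using u assms(3,6) by (simp add: mod_if)
    then have "(x + u) mod N \<noteq> x" using u assms(3,6) by (simp split: if_splits)
    moreover have "(x + u) mod N < N" using assms(3) by simp
    ultimately show ?thesis
      using u assms(3,4,7) inj by (simp add: pow inj_on_eq_iff)
  qed
  then show ?thesis
    using \<open>0 < t\<close> unfolding between_def by (intro CollectI exI[of _ t]) (simp add: pow[of t])
qed

text \<open>Four increasing positions alternate around the cycle. Both orders of the pairs are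
  stated because a crossing is later needed with the two segments in either role.\<close>

lemma separates_cycle:
  assumes cyc: "\<And>i. i < N \<Longrightarrow> \<pi> (h i) = h (Suc i mod N)" and inj: "inj_on h {..<N}"
    and ord: "i < j" "j < k" "k < l" "l < N"
  shows "separates \<pi> (h i) (h k) (h j) (h l)" "separates \<pi> (h j) (h l) (h i) (h k)"
proof -
  have up: "h b \<in> between \<pi> (h a) (h c)" if "a < b" "b < c" "c < N" for a b c
    using between_cycle[of N \<pi> h a c "b - a", OF cyc inj] that by simp
  have "h b \<in> between \<pi> (h a) (h c)" if "c < a" "a < b" "b < N" for a b c
    using between_cycle[of N \<pi> h a c "b - a", OF cyc inj] that by simp
  moreover have "h b \<in> between \<pi> (h a) (h c)" if "b < c" "c < a" "a < N" for a b c
  proof -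
    have "(a + u) mod N \<noteq> c" if "0 < u" "u \<le> N + b - a" for u
    proof -
      have "(a + u) mod N = (if a + u < N then a + u else a + u - N)"
        using that \<open>b < c\<close> \<open>c < a\<close> \<open>a < N\<close> by (simp add: mod_if)
      then show ?thesis using that \<open>b < c\<close> \<open>c < a\<close> \<open>a < N\<close> by (simp split: if_splits)
    qed
    then show ?thesis
      using between_cycle[of N \<pi> h a c "N + b - a", OF cyc inj] that by simp
  qed
  ultimately show "separates \<pi> (h i) (h k) (h j) (h l)" "separates \<pi> (h j) (h l) (h i) (h k)"
    using up ord inj unfolding separates_def by (auto simp: inj_on_eq_iff)
qed

lemma (in rotation_system) opp_opp': "opp H (opp H d) = d"
  using opp_opp opp_outside by metis

lemma (in rotation_system) common_darts_eq:
  "common_darts H P Q = (fst ` set P \<union> opp H ` fst ` set P) \<inter> (fst ` set Q \<union> opp H ` fst ` set Q)"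
proof -
  have "opp H d \<in> D \<longleftrightarrow> d \<in> opp H ` D" for d D using opp_opp' by (metis imageE imageI)
  then show ?thesis unfolding common_darts_def by auto
qed

section \<open>Prescribed trips, and the loop around a heavy square\<close>

context framed_square
begin

lemma step_A:
  assumes "i \<le> r" "k < m j" "k + shift i (j + 1) = p \<or> k + shift i (j + 1) = p + r" "p < r"
  shows "trip_step H i (A j, k) = pos (j + 1) p"
  using trip_step_A[OF assms(1,2)] assms(3,4) by auto

lemma step_B:
  assumes "i \<le> r" "k < m j" "m (j + 3) + k + shift i j = p \<or> m (j + 3) + k + shift i j = p + r" "p < r"
  shows "trip_step H i (B j, k) = pos j p"
  using trip_step_B[OF assms(1,2)] assms(3,4) by auto

lemma step_E:
  assumes "i \<le> r" "t < n j"
    "m (j + 3) + m j + t + shift i j = p \<or> m (j + 3) + m j + t + shift i j = p + r" "p < r"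
  shows "trip_step H i (E j t, 0) = pos j p"
  using trip_step_E[OF assms(1,2)] assms(3,4) by auto

lemma trip_segment_Cons_iff:
  "trip_segment H i (s # s' # P) \<longleftrightarrow>
     s \<in> strands \<and> tgt H (fst s) \<notin> set (bdry H) \<and> trip_step H i s = s' \<and>
     fst s' \<noteq> opp H (fst s) \<and> trip_segment H i (s' # P)"
proof
  assume P: "trip_segment H i (s # s' # P)"
  note c = trip_segment_Cons2[OF P]
  then show "s \<in> strands \<and> tgt H (fst s) \<notin> set (bdry H) \<and> trip_step H i s = s' \<and>
     fst s' \<noteq> opp H (fst s) \<and> trip_segment H i (s' # P)"
    using trip_segment_strands[OF P] by (auto simp: turns_back_def)
qed (auto simp: trip_segment_def turns_back_def strands_def nth_Cons split: nat.split)

lemma trip_segment_exit: "t < n j \<Longrightarrow> trip_segment H i [(X j t, 0)]"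
  by (auto simp: trip_segment_def in_darts mult_X turns_back_def tgt_X L_bdry)

lemma strands_simps:
  "(A j, k) \<in> strands \<longleftrightarrow> k < m j" "(B j, k) \<in> strands \<longleftrightarrow> k < m j"
  "t < n j \<Longrightarrow> (X j t, k) \<in> strands \<longleftrightarrow> k = 0" "t < n j \<Longrightarrow> (E j t, k) \<in> strands \<longleftrightarrow> k = 0"
  by (auto simp: strands_def in_darts mult_A mult_B mult_X mult_E)

lemmas segment_simps = strands_simps ends V_not_bdry opp_A opp_B opp_X opp_E dart_eqs

text \<open>Inverse of \<open>shift\<close> at the corner \<open>c\<close>: a shift can be
  prescribed there whatever the colour.\<close>

definition trip_with_shift :: "4 \<Rightarrow> nat \<Rightarrow> nat" where
  "trip_with_shift c s = (if white H (V c) then s else r - s)"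

lemma shift_trip_with_shift: "s \<le> r \<Longrightarrow> shift (trip_with_shift c s) c = s"
  by (simp add: shift_def trip_with_shift_def)

lemma not_fully_reduced_loop:
  assumes "r < m c + m (c + 1) + m (c + 2)" "r < m (c + 1) + m (c + 2) + m (c + 3)"
  shows "\<not> fully_reduced r H"
proof -
  \<comment> \<open>This shift leads from strand 0 of \<open>A c\<close> to strand 0 of \<open>A (c + 1)\<close>.\<close>
  define i where "i = trip_with_shift (c + 1) (m c)"
  have mp: "0 < m j" for j by (rule m_pos)
  have deg: "m c + m (c + 1) \<le> r" "m (c + 1) + m (c + 2) \<le> r" "m (c + 2) + m (c + 3) \<le> r"
    "m (c + 3) + m c \<le> r"
    using m_le_r(1)[of c] m_le_r(1)[of "c + 1"] m_le_r(1)[of "c + 2"] m_le_r(1)[of "c + 3"] by simp_all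
  have i: "1 \<le> i" "i \<le> r - 1" "i \<le> r"
    using deg mp[of c] mp[of "c + 1"] by (auto simp: i_def trip_with_shift_def)
  have sh: "shift i (c + 1) = m c" "shift i (c + 2) = r - m c" "shift i (c + 3) = m c"
    "shift i c = r - m c"
  proof -
    show 1: "shift i (c + 1) = m c" using deg by (simp add: i_def shift_trip_with_shift)
    show "shift i (c + 2) = r - m c" "shift i (c + 3) = m c" "shift i c = r - m c"
      using shift_simps[OF i(3), of "c + 1"] 1 by simp_all
  qed
  \<comment> \<open>The turns at \<open>V (c + 2)\<close> and \<open>V (c + 3)\<close> force these
    strands. The two hypotheses say exactly that they fit into \<open>A (c + 2)\<close> and
    \<open>A (c + 3)\<close>.\<close>
  define k2 k3 where "k2 = r - m c - m (c + 1)" and "k3 = r - m (c + 1) - m (c + 2)"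
  let ?P = "[(A c, 0), (A (c + 1), 0), (A (c + 2), k2), (A (c + 3), k3)]"
  have k: "k2 < m (c + 2)" "k3 < m (c + 3)"
    using assms mp[of "c + 2"] mp[of "c + 3"] unfolding k2_def k3_def by linarith+
  have "trip_step H i (A (c + 3), k3) = pos (c + 3 + 1) (k3 + (r - m c))"
    using k sh i deg assms by (intro step_A) (auto simp: k3_def)
  \<comment> \<open>A segment must not turn back even after its last strand. The position reached at
    \<open>V c\<close> lies past the strands of \<open>B (c + 3)\<close>.\<close>
  moreover have "fst (pos c (k3 + (r - m c))) \<noteq> B (c + 3)"
  proof -
    obtain d l where "pos c (k3 + (r - m c)) = (d, l)" by (cases "pos c (k3 + (r - m c))")
    moreover have "k3 + (r - m c) < r" "m (c + 3) \<le> k3 + (r - m c)"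
      using deg assms mp[of c] unfolding k3_def by linarith+
    ultimately have "d \<noteq> B (c + 3)" by (elim pos_cases) (auto simp: dart_eqs)
    then show ?thesis using \<open>pos c _ = (d, l)\<close> by simp
  qed
  ultimately have "fst (trip_step H i (A (c + 3), k3)) \<noteq> opp H (A (c + 3))"
    by (simp add: opp_A)
  then have 4: "trip_segment H i [(A (c + 3), k3)]"
    using k by (auto simp: trip_segment_def turns_back_def in_darts mult_A)
  have "trip_step H i (A (c + 2), k2) = pos (c + 2 + 1) (m (c + 2) + k3)"
    using k sh i deg assms by (intro step_A) (auto simp: k2_def k3_def)
  then have 3: "trip_segment H i [(A (c + 2), k2), (A (c + 3), k3)]"
    using 4 k pos_simps(2)[of k3 "c + 3"] by (subst trip_segment_Cons_iff) (simp add: segment_simps)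
  have "trip_step H i (A (c + 1), 0) = pos (c + 1 + 1) (m (c + 1) + k2)"
    using k sh i deg assms mp by (intro step_A) (auto simp: k2_def)
  then have 2: "trip_segment H i [(A (c + 1), 0), (A (c + 2), k2), (A (c + 3), k3)]"
    using 3 k mp pos_simps(2)[of k2 "c + 2"] by (subst trip_segment_Cons_iff) (simp add: segment_simps)
  have "trip_step H i (A c, 0) = pos (c + 1) (m c + 0)"
    using k sh i deg assms mp[of "c + 1"] mp by (intro step_A) auto
  then have "trip_segment H i ?P"
    using 2 k mp pos_simps(2)[of 0 "c + 1"] by (subst trip_segment_Cons_iff) (simp add: segment_simps)
  moreover have "\<not> distinct (visits H ?P)" by (simp add: visits_def ends)
  ultimately show ?thesis using i unfolding fully_reduced_def by blast
qed

section \<open>Arcs around a corner and around a contracted edge\<close>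

definition vertex_cycle :: "4 \<Rightarrow> nat \<Rightarrow> 'a" where
  "vertex_cycle j i = (if i = 0 then B (j + 3) else if i = 1 then A j else X j (i - 2))"

lemma vertex_cycle:
  assumes "A j \<notin> S" "B (j + 3) \<notin> S" "\<And>t. t < n j \<Longrightarrow> X j t \<notin> S" "i < n j + 2"
  shows "contracted_rot H S (vertex_cycle j i) = vertex_cycle j (Suc i mod (n j + 2))"
proof -
  consider "i = 0" | "i = 1" | t where "i = t + 2" "t < n j" using assms(4)
    by (metis One_nat_def Suc_1 add.commute add_less_cancel_right less_2_cases_iff
        less_imp_add_positive linorder_not_less nat_le_iff_add)
  then show ?thesis
  proof cases
    case 3
    then show ?thesis
      using assms(3)[of t] by (cases "n j = Suc t") (auto simp: vertex_cycle_def contracted_rot_def rot_X)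
  qed (use assms in \<open>auto simp: vertex_cycle_def contracted_rot_def rot_A rot_B mod_if\<close>)
qed

lemma vertex_cycle_inj: "inj_on (vertex_cycle j) {..<n j + 2}"
  by (rule inj_onI) (auto simp: vertex_cycle_def dart_eqs split: if_splits)

text \<open>The arcs around the vertex that results from contracting the edge between \<open>V j\<close> and
  \<open>V (j + 1)\<close>.\<close>

definition edge_cycle :: "4 \<Rightarrow> nat \<Rightarrow> 'a" where
  "edge_cycle j i =
     (if i = 0 then B (j + 3) else if i = 1 then A j else if i = 2 then A (j + 1)
      else if i < n (j + 1) + 3 then X (j + 1) (i - 3)
      else if i = n (j + 1) + 3 then B j else X j (i - (n (j + 1) + 4)))"

text \<open>\<open>A j\<close> and \<open>B j\<close> stay in the cycle as markers: at each of them
  the contracted rotation continues at the other end of the edge, with the successor of the opposite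
  arc. This accounts for the length \<open>n (j + 1) + n j + 4\<close>.\<close>

lemma edge_cycle:
  assumes "A j \<in> S" "B j \<in> S" "A (j + 1) \<notin> S" "B (j + 3) \<notin> S"
    "\<And>t. t < n j \<Longrightarrow> X j t \<notin> S" "\<And>t. t < n (j + 1) \<Longrightarrow> X (j + 1) t \<notin> S"
    "i < n (j + 1) + n j + 4"
  shows "contracted_rot H S (edge_cycle j i) = edge_cycle j (Suc i mod (n (j + 1) + n j + 4))"
proof -
  have rotB: "rot H (B j) = A (j + 1)" using rot_B[of "j + 1"] by simp
  have rotA: "rot H (A (j + 1)) = (if n (j + 1) = 0 then B j else X (j + 1) 0)"
    using rot_A[of "j + 1"] by simp
  have rotX: "rot H (X (j + 1) t) = (if Suc t < n (j + 1) then X (j + 1) (Suc t) else B j)"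
    if "t < n (j + 1)" for t
    using rot_X[OF that] by simp
  consider "i = 0" | "i = 1" | "i = 2" | t where "i = t + 3" "t < n (j + 1)" | "i = n (j + 1) + 3"
    | t where "i = n (j + 1) + 4 + t" "t < n j"
  proof -
    have "i = 0 \<or> i = 1 \<or> i = 2 \<or> (\<exists>t. i = t + 3 \<and> t < n (j + 1)) \<or> i = n (j + 1) + 3 \<or>
      (\<exists>t. i = n (j + 1) + 4 + t \<and> t < n j)"
      using assms(7) by presburger
    then show thesis using that by blast
  qed
  then show ?thesis
  proof cases
    case (4 t)
    then show ?thesis
      using assms(6)[of t]
      by (cases "n (j + 1) = Suc t") (auto simp: edge_cycle_def contracted_rot_def rotX mod_if)
  next
    case (6 t)
    show ?thesis
    proof (cases "n j = Suc t")
      case True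
      then have "Suc i = n (j + 1) + n j + 4" using 6 by simp
      then have "Suc i mod (n (j + 1) + n j + 4) = 0" by (simp only: mod_self)
      then show ?thesis
        using assms(5)[of t] 6 True by (simp add: edge_cycle_def contracted_rot_def rot_X)
    next
      case False
      then show ?thesis
        using assms(5)[of t] 6 by (auto simp: edge_cycle_def contracted_rot_def rot_X)
    qed
  qed (use assms in
      \<open>auto simp: edge_cycle_def contracted_rot_def rot_A rot_B rotA rotB opp_A opp_B mod_if\<close>)
qed

lemma edge_cycle_inj: "inj_on (edge_cycle j) {..<n (j + 1) + n j + 4}"
  by (rule inj_onI) (auto simp: edge_cycle_def dart_eqs split: if_splits)

text \<open>The larger shift has the larger trip index at a white corner and the smaller one at a
  black corner, so the colour decides in which order the pair violates the condition. This is why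
  the double crossing is assumed in both orders.\<close>

lemma double_crossing_not_fully_reduced:
  assumes "0 < s" "Suc s < r"
    and P: "trip_segment H (trip_with_shift c (Suc s)) P" and Q: "trip_segment H (trip_with_shift c s) Q"
    and "oriented_double_crossing H P Q" "oriented_double_crossing H Q P"
  shows "\<not> fully_reduced r H"
proof (cases "white H (V c)")
  case True
  then have "trip_with_shift c (Suc s) = trip_with_shift c s + 1"
    "1 \<le> trip_with_shift c s" "trip_with_shift c s + 1 \<le> r - 1"
    using assms(1,2) by (auto simp: trip_with_shift_def)
  then show ?thesis using P Q assms(6) unfolding fully_reduced_def by metis
next
  case False
  then have "trip_with_shift c s = trip_with_shift c (Suc s) + 1"
    "1 \<le> trip_with_shift c (Suc s)" "trip_with_shift c (Suc s) + 1 \<le> r - 1"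
    using assms(1,2) by (auto simp: trip_with_shift_def)
  then show ?thesis using P Q assms(5) unfolding fully_reduced_def by metis
qed

lemma not_fully_reduced_crossing:
  assumes heavy: "r < m c + m (c + 1) + m (c + 2) + m (c + 3)"
    and le0: "m (c + 1) + m (c + 2) + m (c + 3) \<le> r" and le2: "m c + m (c + 1) + m (c + 3) \<le> r"
  shows "\<not> fully_reduced r H"
proof -
  \<comment> \<open>With this value the turn of \<open>P\<close> at \<open>V (c + 1)\<close> takes
    strand 0 of \<open>A c\<close> to the last strand of \<open>A (c + 1)\<close>, which is
    \<open>t0\<close> below. The same \<open>t0\<close>, as an exit number at \<open>V c\<close>,
    puts the first turns of \<open>P\<close> and \<open>Q\<close> on the two sides of the border
    between \<open>A c\<close> and \<open>B (c + 3)\<close>.\<close>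
  define s where "s = r - m c - m (c + 1)"
  define iP iQ where "iP = trip_with_shift c (Suc s)" and "iQ = trip_with_shift c s"
  have mp: "0 < m c" "0 < m (c + 1)" "0 < m (c + 2)" "0 < m (c + 3)" by (simp_all add: m_pos)
  have deg: "m c + m (c + 1) + n (c + 1) = r" "m (c + 1) + m (c + 2) + n (c + 2) = r"
    "m (c + 2) + m (c + 3) + n (c + 3) = r" "m (c + 3) + m c + n c = r"
    using m_degree[of c] m_degree[of "c + 1"] m_degree[of "c + 2"] m_degree[of "c + 3"] by simp_all
  have s: "0 < s" "Suc s < r" "s + m c + m (c + 1) = r" using mp le2 by (auto simp: s_def)
  have le: "iP \<le> r" "iQ \<le> r" using s by (auto simp: iP_def iQ_def trip_with_shift_def)
  have "shift iP c = Suc s" "shift iQ c = s"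
    using s by (simp_all add: iP_def iQ_def shift_trip_with_shift)
  then have sh: "shift iP c = Suc s" "shift iP (c + 1) = r - Suc s" "shift iP (c + 2) = Suc s"
    "shift iP (c + 3) = r - Suc s" "shift iQ c = s" "shift iQ (c + 2) = s" "shift iQ (c + 3) = r - s"
    using shift_simps[OF le(1), of c] shift_simps[OF le(2), of c] by simp_all
  \<comment> \<open>From here, P gets to the first strand of \<open>A c\<close> and Q to the last one of \<open>B (c + 3)\<close>.\<close>
  define t0 tQ where "t0 = m (c + 1) - 1" and "tQ = m (c + 3) - 1"
  \<comment> \<open>The strand of \<open>B (c + 2)\<close> reached by \<open>Q\<close>: heaviness
    makes the subtraction exact, and \<open>le2\<close> keeps the result below
    \<open>m (c + 2)\<close>. The following turn leads to exit number \<open>tQ\<close> at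
    \<open>V (c + 2)\<close>, so \<open>tQ\<close> serves twice.\<close>
  define kQ where "kQ = m c + m (c + 1) + m (c + 2) + m (c + 3) - 1 - r"
  have lt: "t0 < n c" "tQ < n (c + 2)" "t0 < m (c + 1)" "tQ < m (c + 3)" "kQ < m (c + 2)"
    using deg mp heavy le0 le2 unfolding t0_def tQ_def kQ_def by linarith+
  let ?e = "(E c t0, 0)" and ?x = "(X (c + 2) tQ, 0)"
  define Q where "Q = [?e, (B (c + 3), tQ), (B (c + 2), kQ), ?x]"
  have segQ: "trip_segment H iQ Q"
  proof -
    have eqs: "m (c + 3) + m c + t0 + s = tQ + r" "m (c + 2) + tQ + (r - s) = kQ + r"
      "m (c + 1) + kQ + s = m (c + 1) + m (c + 2) + tQ"
      using s mp heavy unfolding t0_def tQ_def kQ_def by linarith+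
    have less: "tQ < r" "kQ < r" "m (c + 1) + m (c + 2) + tQ < r"
      using lt deg by linarith+
    have "trip_step H iQ ?e = pos c tQ"
      using le lt sh eqs less by (intro step_E) simp_all
    then have 1: "trip_step H iQ ?e = pos (c + 3 + 1) tQ" by simp
    have "trip_step H iQ (B (c + 3), tQ) = pos (c + 3) kQ"
      using le lt sh eqs less by (intro step_B) simp_all
    then have 2: "trip_step H iQ (B (c + 3), tQ) = pos (c + 2 + 1) kQ" by simp
    have 3: "trip_step H iQ (B (c + 2), kQ) = pos (c + 2) (m (c + 2 + 3) + m (c + 2) + tQ)"
      using le lt sh eqs less by (intro step_B) simp_all
    have "trip_segment H iQ [(B (c + 2), kQ), ?x]"
      using lt 3 pos_simps(3)[of "c + 2" tQ]
      by (subst trip_segment_Cons_iff) (simp add: segment_simps trip_segment_exit)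
    then have "trip_segment H iQ [(B (c + 3), tQ), (B (c + 2), kQ), ?x]"
      using lt 2 pos_simps(1)[OF lt(5)] by (subst trip_segment_Cons_iff) (simp add: segment_simps)
    then show ?thesis
      unfolding Q_def
      using lt 1 pos_simps(1)[OF lt(4)] by (subst trip_segment_Cons_iff) (simp add: segment_simps)
  qed
  have eqs: "m (c + 3) + m c + t0 + Suc s = m (c + 3) + r" "r - Suc s = m c + t0"
    using s mp unfolding t0_def by linarith+
  have less: "m (c + 3) < r" "m c + t0 < r"
    using lt deg mp by linarith+
  have stepP1: "trip_step H iP ?e = pos c (m (c + 3) + 0)"
    using le lt sh eqs less by (intro step_E) simp_all
  have stepP2: "trip_step H iP (A c, 0) = pos (c + 1) (m (c + 1 + 3) + t0)"
    using le mp sh eqs less by (intro step_A) simp_all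
  have segP: "trip_segment H iP (?e # (A c, 0) # (A (c + 1), t0) # R)"
    if "trip_segment H iP ((A (c + 1), t0) # R)" for R
  proof -
    have "trip_segment H iP ((A c, 0) # (A (c + 1), t0) # R)"
      using that mp stepP2 pos_simps(2)[OF lt(3)]
      by (subst trip_segment_Cons_iff) (simp add: segment_simps)
    then show ?thesis
      using lt stepP1 pos_simps(2)[OF mp(1)]
      by (subst trip_segment_Cons_iff) (simp add: segment_simps)
  qed
  have start: "essential_intersection H (?e # P) (?e # Q') 0 0" for P Q'
    using lt unfolding essential_intersection_def end_at_def by (auto simp: ends L_bdry)
  have start': "essential_intersection H P Q' 0 0"
    if "P = ?e # P1" "Q' = ?e # Q1" for P Q' P1 Q1
    using start that by simp
  have comm: "common_darts H Q P = common_darts H P Q" for P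
    by (auto simp: common_darts_def)
  show ?thesis
  proof (cases "m c + m (c + 1) + m (c + 2) \<le> r")
    case True
    define tP where "tP = r - m c - m (c + 1) - m (c + 2)"
    \<comment> \<open>Here \<open>tP \<le> tQ\<close> is equivalent to the square being heavy:
      clockwise, \<open>P\<close> leaves no later than \<open>Q\<close>.\<close>
    have tP: "tP < n (c + 2)" "tP \<le> tQ" using True deg heavy mp unfolding tP_def tQ_def by linarith+
    let ?y = "(X (c + 2) tP, 0)"
    define P where "P = [?e, (A c, 0), (A (c + 1), t0), ?y]"
    have "t0 + Suc s = m (c + 1) + m (c + 2) + tP" "m (c + 1) + m (c + 2) + tP < r"
      using s True mp tP deg unfolding t0_def tP_def by linarith+
    then have "trip_step H iP (A (c + 1), t0) = pos (c + 1 + 1) (m (c + 1) + m (c + 2) + tP)"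
      using le lt sh by (intro step_A) simp_all
    then have "trip_segment H iP [(A (c + 1), t0), ?y]"
      using lt tP pos_simps(3)[of "c + 2" tP]
      by (subst trip_segment_Cons_iff) (simp add: segment_simps trip_segment_exit)
    then have P: "trip_segment H iP P" using segP unfolding P_def by blast
    have "essential_intersection H P Q 2 2 \<and> essential_intersection H Q P 2 2"
    proof (cases "tP = tQ")
      case True
      have S: "common_darts H P Q = {E c t0, X c t0, X (c + 2) tQ, E (c + 2) tQ}"
        unfolding common_darts_eq P_def Q_def True using lt by (auto simp: segment_simps)
      have walks: "contracted_walk (common_darts H P Q) P = [A c, A (c + 1)]"
        "contracted_walk (common_darts H P Q) Q = [B (c + 3), B (c + 2)]"
        unfolding contracted_walk_def S using lt by (auto simp: P_def Q_def True dart_eqs)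
      \<comment> \<open>Both segments leave by the same boundary edge. It is contracted, so the
        second intersection is at the end position 2 of both walks.\<close>
      have "end_at H (common_darts H P Q) P 2 (L (c + 2) tQ)"
        "end_at H (common_darts H P Q) Q 2 (L (c + 2) tQ)"
        unfolding end_at_def walks using lt by (simp_all add: P_def Q_def True ends)
      then show ?thesis
        using L_bdry[OF lt(2)] comm unfolding essential_intersection_def by metis
    next
      case False
      let ?S = "common_darts H P Q"
      have S: "?S = {E c t0, X c t0}"
        unfolding common_darts_eq P_def Q_def using lt tP False by (auto simp: segment_simps)
      have walks: "contracted_walk ?S P = [A c, A (c + 1), X (c + 2) tP]"
        "contracted_walk ?S Q = [B (c + 3), B (c + 2), X (c + 2) tQ]"
        unfolding contracted_walk_def S using lt tP by (auto simp: P_def Q_def dart_eqs)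
      have notS: "A (c + 2) \<notin> ?S" "B (c + 2 + 3) \<notin> ?S" "\<And>t. t < n (c + 2) \<Longrightarrow> X (c + 2) t \<notin> ?S"
        unfolding S using lt by (auto simp: dart_eqs)
      have cyc: "vertex_cycle (c + 2) 0 = B (c + 1)" "vertex_cycle (c + 2) 1 = A (c + 2)"
        "vertex_cycle (c + 2) (2 + t) = X (c + 2) t" for t
        by (simp_all add: vertex_cycle_def)
      \<comment> \<open>Clockwise around \<open>V (c + 2)\<close>: \<open>P\<close> enters,
        \<open>Q\<close> enters, \<open>P\<close> leaves, \<open>Q\<close> leaves.\<close>
      have "0 < (1 :: nat)" "1 < 2 + tP" "2 + tP < 2 + tQ" "2 + tQ < n (c + 2) + 2"
        using lt tP False by auto
      note sep = separates_cycle[OF vertex_cycle[OF notS] vertex_cycle_inj this, unfolded cyc]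
      have "crosses_at H P Q 2 2" "crosses_at H Q P 2 2"
        unfolding crosses_at_def comm walks Let_def using sep by (simp_all add: opp_A opp_B)
      then show ?thesis by (simp add: essential_intersection_def)
    qed
    then have "oriented_double_crossing H P Q" "oriented_double_crossing H Q P"
      using start'[OF P_def Q_def] start'[OF Q_def P_def] unfolding oriented_double_crossing_def
      by (metis zero_less_numeral)+
    then show ?thesis
      using double_crossing_not_fully_reduced[OF s(1,2)] P segQ unfolding iP_def iQ_def by blast
  next
    case False
    \<comment> \<open>From strand \<open>t0\<close> of \<open>A (c + 1)\<close> the turn leads to
      position \<open>r - m c\<close>, which now lies in \<open>A (c + 2)\<close>. The next turn
      ends at position \<open>r - 1\<close> of \<open>V (c + 3)\<close>, the last exit
      there.\<close>
    define kP tP where "kP = r - m c - m (c + 1)" and "tP = n (c + 3) - 1"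
    have kP: "kP < m (c + 2)" "tP < n (c + 3)"
      using deg False le0 mp unfolding kP_def tP_def by linarith+
    let ?y = "(X (c + 3) tP, 0)"
    define P where "P = [?e, (A c, 0), (A (c + 1), t0), (A (c + 2), kP), ?y]"
    have "t0 + Suc s = m (c + 1) + kP" "m (c + 1) + kP < r"
      "kP + (r - Suc s) = m (c + 2) + m (c + 3) + tP" "m (c + 2) + m (c + 3) + tP < r"
      using s mp kP deg unfolding t0_def tP_def kP_def by linarith+
    note eqs = this
    have 1: "trip_step H iP (A (c + 1), t0) = pos (c + 1 + 1) (m (c + 2 + 3) + kP)"
      using le lt sh eqs by (intro step_A) simp_all
    have 2: "trip_step H iP (A (c + 2), kP) = pos (c + 2 + 1) (m (c + 3 + 3) + m (c + 3) + tP)"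
      using le kP sh eqs by (intro step_A) simp_all
    have "trip_segment H iP [(A (c + 2), kP), ?y]"
      using lt kP 2 pos_simps(3)[of "c + 3" tP]
      by (subst trip_segment_Cons_iff) (simp add: segment_simps trip_segment_exit)
    then have "trip_segment H iP [(A (c + 1), t0), (A (c + 2), kP), ?y]"
      using lt kP 1 pos_simps(2)[OF kP(1)]
      by (subst trip_segment_Cons_iff) (simp add: segment_simps)
    then have P: "trip_segment H iP P" using segP unfolding P_def by blast
    let ?S = "common_darts H P Q"
    \<comment> \<open>\<open>P\<close> and \<open>Q\<close> run along hourglass \<open>c + 2\<close>
      in opposite directions. It drops out of both walks, which puts the crossing at position 2 of
      \<open>P\<close> and position 1 of \<open>Q\<close>.\<close>
    have S: "?S = {E c t0, X c t0, A (c + 2), B (c + 2)}"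
      unfolding common_darts_eq P_def Q_def using lt kP by (auto simp: segment_simps)
    have walks: "contracted_walk ?S P = [A c, A (c + 1), X (c + 3) tP]"
      "contracted_walk ?S Q = [B (c + 3), X (c + 2) tQ]"
      unfolding contracted_walk_def S using lt kP by (auto simp: P_def Q_def dart_eqs)
    have inS: "A (c + 2) \<in> ?S" "B (c + 2) \<in> ?S" "A (c + 2 + 1) \<notin> ?S" "B (c + 2 + 3) \<notin> ?S"
      "\<And>t. t < n (c + 2) \<Longrightarrow> X (c + 2) t \<notin> ?S" "\<And>t. t < n (c + 2 + 1) \<Longrightarrow> X (c + 2 + 1) t \<notin> ?S"
      unfolding S using lt by (auto simp: dart_eqs)
    have cyc: "edge_cycle (c + 2) 0 = B (c + 1)" "edge_cycle (c + 2) 2 = A (c + 3)"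
      "edge_cycle (c + 2) (3 + tP) = X (c + 3) tP"
      "edge_cycle (c + 2) (n (c + 3) + 4 + tQ) = X (c + 2) tQ"
      using kP by (simp_all add: edge_cycle_def)
    \<comment> \<open>Clockwise around the contracted edge: \<open>P\<close> enters at
      \<open>V (c + 2)\<close>, \<open>Q\<close> enters at \<open>V (c + 3)\<close>,
      \<open>P\<close> leaves from \<open>V (c + 3)\<close>, \<open>Q\<close> leaves from
      \<open>V (c + 2)\<close>.\<close>
    have "0 < (2 :: nat)" "2 < 3 + tP" "3 + tP < n (c + 3) + 4 + tQ"
      "n (c + 3) + 4 + tQ < n (c + 2 + 1) + n (c + 2) + 4"
      using lt kP by auto
    note sep = separates_cycle[OF edge_cycle[OF inS] edge_cycle_inj this, unfolded cyc]
    have "crosses_at H P Q 2 1" "crosses_at H Q P 1 2"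
      unfolding crosses_at_def comm walks Let_def using sep by (simp_all add: opp_A opp_B)
    then have "essential_intersection H P Q 2 1 \<and> essential_intersection H Q P 1 2"
      by (simp add: essential_intersection_def)
    then have "oriented_double_crossing H P Q" "oriented_double_crossing H Q P"
      using start'[OF P_def Q_def] start'[OF Q_def P_def] unfolding oriented_double_crossing_def
      by (metis zero_less_numeral zero_less_one)+
    then show ?thesis
      using double_crossing_not_fully_reduced[OF s(1,2)] P segQ unfolding iP_def iQ_def by blast
  qed
qed

theorem fully_reduced_iff: "fully_reduced r H \<longleftrightarrow> m 0 + m 1 + m 2 + m 3 \<le> r"
proof
  assume "m 0 + m 1 + m 2 + m 3 \<le> r"
  then have "m j + m (j + 1) + m (j + 2) + m (j + 3) \<le> r" for j
    using exhaust_index4[of j 0] by (auto simp: numeral_index4)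
  then show "fully_reduced r H" by (intro fully_reduced_if_small) (simp add: small_square_def)
next
  assume red: "fully_reduced r H"
  show "m 0 + m 1 + m 2 + m 3 \<le> r"
  proof (rule ccontr)
    assume "\<not> ?thesis"
    then have heavy: "r < m 0 + m 1 + m 2 + m 3" by simp
    \<comment> \<open>Some T(j) exceeds \<open>r\<close> in each of the two opposite pairs. Members
      of different pairs are cyclically adjacent, so one of the four loops below applies.\<close>
    have "\<not> (m 1 + m 2 + m 3 \<le> r \<and> m 0 + m 1 + m 3 \<le> r)"
      using not_fully_reduced_crossing[of 0] heavy red by (auto simp: numeral_index4)
    moreover have "\<not> (m 2 + m 3 + m 0 \<le> r \<and> m 1 + m 2 + m 0 \<le> r)"
      using not_fully_reduced_crossing[of 1] heavy red by (auto simp: numeral_index4)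
    moreover have "\<not> (r < m 0 + m 1 + m 2 \<and> r < m 1 + m 2 + m 3)"
      using not_fully_reduced_loop[of 0] red by (auto simp: numeral_index4)
    moreover have "\<not> (r < m 1 + m 2 + m 3 \<and> r < m 2 + m 3 + m 0)"
      using not_fully_reduced_loop[of 1] red by (auto simp: numeral_index4)
    moreover have "\<not> (r < m 2 + m 3 + m 0 \<and> r < m 3 + m 0 + m 1)"
      using not_fully_reduced_loop[of 2] red by (auto simp: numeral_index4)
    moreover have "\<not> (r < m 3 + m 0 + m 1 \<and> r < m 0 + m 1 + m 2)"
      using not_fully_reduced_loop[of 3] red by (auto simp: numeral_index4)
    ultimately show False by linarith
  qed
qed

end

subsection \<open>The graph of a square face\<close>

lemma image_Collect2: "f ` {g x y |x y. P x y} = {f (g x y) |x y. P x y}"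
  by auto

lemma orbit_enumeration:
  assumes "x \<in> orbit f x"
  shows "orbit f x = (\<lambda>p. (f ^^ p) x) ` {..<card (orbit f x)}"
    and "inj_on (\<lambda>p. (f ^^ p) x) {..<card (orbit f x)}"
    and "(f ^^ card (orbit f x)) x = x"
proof -
  let ?k = "funpow_dist1 f x x"
  have "card (orbit f x) = ?k"
    using orbit_conv_funpow_dist1[OF assms] inj_on_funpow_dist1[OF assms]
    by (metis card_image card_atLeastLessThan diff_zero)
  then show "orbit f x = (\<lambda>p. (f ^^ p) x) ` {..<card (orbit f x)}"
    "inj_on (\<lambda>p. (f ^^ p) x) {..<card (orbit f x)}" "(f ^^ card (orbit f x)) x = x"
    using orbit_conv_funpow_dist1[OF assms] inj_on_funpow_dist1[OF assms] funpow_dist1_prop[OF assms]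
    by (simp_all only: lessThan_atLeast0)
qed

sublocale hourglass_plabic_graph \<subseteq> rotation_system G
proof
  fix d assume d: "d \<in> darts G"
  then have "tail (base G) d \<in> verts (base G)" "d \<in> out_arcs (base G) (src G d)" by auto
  then have "rot G d \<in> out_arcs (base G) (src G d)"
    using rot_cyclic[of "src G d"] cyclic_on_inI[of "rot G" _ d] by blast
  then show "src G (rot G d) = src G d" by simp
qed (use rot_permutes mult_pos mult_opp arev_eq in simp_all)

context hourglass_plabic_graph
begin

lemma cw_funpow_within:
  assumes "k < mult G d"
  shows "(cw_strand G ^^ k) (d, 0) = (d, k)"
  using assms by (induction k) auto

lemma cw_funpow_mult:
  assumes "d \<in> darts G"
  shows "(cw_strand G ^^ mult G d) (d, 0) = (rot G d, 0)"
  using cw_funpow_within[of "mult G d - 1" d] mult_pos[OF assms]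
  by (cases "mult G d") auto

text \<open>The cycle of \<open>rot\<close> lifts to a single cycle of \<open>cw_strand\<close>,
  because \<open>mult G x\<close> steps pass the hourglass of \<open>x\<close>. Its length counts
  the strands at the vertex, which is \<open>r\<close> by the degree condition.\<close>

lemma strands_at_vertex:
  assumes d: "d \<in> darts G" and v: "src G d \<notin> set (bdry G)"
  shows "{(x, k). x \<in> darts G \<and> src G x = src G d \<and> k < mult G x} =
      (\<lambda>p. (cw_strand G ^^ p) (d, 0)) ` {..<r}"
    and "inj_on (\<lambda>p. (cw_strand G ^^ p) (d, 0)) {..<r}"
    and "(cw_strand G ^^ r) (d, 0) = (d, 0)"
proof -
  let ?W = "{(x, k). x \<in> darts G \<and> src G x = src G d \<and> k < mult G x}"
  have cyc: "cyclic_on (rot G) (out_arcs (base G) (src G d))"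
  proof (rule rot_cyclic)
    show "out_arcs (base G) (src G d) \<noteq> {}" using d by (metis empty_iff in_out_arcs_conv)
  qed (use d in simp)
  have out: "orbit (rot G) d = out_arcs (base G) (src G d)"
    using orbit_cyclic_eq3[OF cyc] d by auto
  have sub: "orbit (cw_strand G) (d, 0) \<subseteq> ?W"
  proof
    fix s assume "s \<in> orbit (cw_strand G) (d, 0)"
    then show "s \<in> ?W"
    proof induction
      case base
      show ?case using cw_strand_strands[of "(d, 0)"] d mult_pos[OF d]
        by (auto simp: strands_def case_prod_beta)
    next
      case (step s)
      then show ?case using cw_strand_strands[of s] by (auto simp: strands_def case_prod_beta)
    qed
  qed
  have start: "(x, 0) \<in> orbit (cw_strand G) (d, 0)" if "x \<in> orbit (rot G) d" for x
    using that
  proof induction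
    case base
    show ?case unfolding orbit_altdef cw_funpow_mult[OF d, symmetric] using mult_pos[OF d] by blast
  next
    case (step x)
    then have "x \<in> darts G" using out by auto
    then show ?case using step cw_funpow_mult[of x] funpow_in_orbit[OF step.IH] by metis
  qed
  have "?W \<subseteq> orbit (cw_strand G) (d, 0)"
  proof
    fix s assume "s \<in> ?W"
    then obtain x k where s: "s = (x, k)" "x \<in> out_arcs (base G) (src G d)" "k < mult G x" by auto
    then show "s \<in> orbit (cw_strand G) (d, 0)"
      using funpow_in_orbit[OF start[of x], of k] cw_funpow_within[of k x] out by simp
  qed
  then have W: "orbit (cw_strand G) (d, 0) = ?W" using sub by auto
  have self: "(d, 0) \<in> orbit (cw_strand G) (d, 0)" using d mult_pos[OF d] W by auto
  have "?W = Sigma (out_arcs (base G) (src G d)) (\<lambda>x. {..<mult G x})" by auto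
  moreover have "finite (out_arcs (base G) (src G d))"
    by (rule finite_subset[of _ "darts G"]) auto
  ultimately have "card ?W = (\<Sum>x\<in>out_arcs (base G) (src G d). mult G x)" by simp
  also have "\<dots> = r" using internal_degree[of "src G d"] d v by auto
  finally have "card (orbit (cw_strand G) (d, 0)) = r" using W by simp
  then show "?W = (\<lambda>p. (cw_strand G ^^ p) (d, 0)) ` {..<r}"
    "inj_on (\<lambda>p. (cw_strand G ^^ p) (d, 0)) {..<r}" "(cw_strand G ^^ r) (d, 0) = (d, 0)"
    using orbit_enumeration[OF self] W by simp_all
qed

end

text \<open>The arcs \<open>a j\<close> run around the face, which is on their left.\<close>

locale square_in_graph = hourglass_plabic_graph r G
  for r :: nat and G :: "('v, 'a) hourglass_graph" +
  fixes a :: "4 \<Rightarrow> 'a"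
  assumes a_darts: "a j \<in> darts G"
    and tgt_a: "tgt G (a j) = src G (a (j + 1))"
    and rot_opp_a: "rot G (opp G (a j)) = a (j + 1)"
    and src_a_eq: "src G (a i) = src G (a j) \<longleftrightarrow> i = j"
    and src_a_internal: "src G (a j) \<notin> set (bdry G)"
begin

definition sq :: "'a set" where
  "sq = range a \<union> opp G ` range a"

text \<open>Counterpart of \<open>pos\<close> in the ambient graph: \<open>opp G (a (j + 3))\<close>
  will become \<open>B (j + 3)\<close>.\<close>

definition corner_strand :: "4 \<Rightarrow> nat \<Rightarrow> 'a strand" where
  "corner_strand j p = (cw_strand G ^^ p) (opp G (a (j + 3)), 0)"

abbreviation ma :: "4 \<Rightarrow> nat" where
  "ma j \<equiv> mult G (a j)"

definition na :: "4 \<Rightarrow> nat" where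
  "na j = r - (ma (j + 3) + ma j)"

definition outer :: "4 \<Rightarrow> nat \<Rightarrow> 'a strand" where
  "outer j t = corner_strand j (ma (j + 3) + ma j + t)"

lemma src_opp_a: "src G (opp G (a j)) = src G (a (j + 1))"
  using src_opp[OF a_darts] tgt_a by simp

lemma opp_a_darts: "opp G (a j) \<in> darts G"
  using opp_darts a_darts by simp

lemma mult_opp_a: "mult G (opp G (a j)) = ma j"
  using mult_opp a_darts by simp

lemma a_eq: "a i = a j \<longleftrightarrow> i = j"
  using src_a_eq by metis

lemma a_neq_opp_a: "a i \<noteq> opp G (a j)"
proof
  assume eq: "a i = opp G (a j)"
  then have "i = j + 1" using src_opp_a src_a_eq by metis
  moreover have "tgt G (a i) = src G (a j)" using eq tgt_opp[OF a_darts] by simp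
  then have "i + 1 = j" using tgt_a src_a_eq by metis
  ultimately show False by simp
qed

lemma sq_darts: "sq \<subseteq> darts G"
  using a_darts opp_a_darts by (auto simp: sq_def)

lemma src_sq: "src G ` sq = range (\<lambda>j. src G (a j))"
  by (auto simp: sq_def src_opp_a)

lemma sq_at_corner: "d \<in> sq \<Longrightarrow> src G d = src G (a j) \<Longrightarrow> d = a j \<or> d = opp G (a (j + 3))"
  by (auto simp: sq_def src_opp_a src_a_eq)

lemma ma_pos: "0 < ma j"
  using mult_pos a_darts by simp

lemma corner:
  "{(x, k). x \<in> darts G \<and> src G x = src G (a j) \<and> k < mult G x} = corner_strand j ` {..<r}"
  "inj_on (corner_strand j) {..<r}"
  "corner_strand j r = (opp G (a (j + 3)), 0)"
  using strands_at_vertex[OF opp_a_darts, of "j + 3"] src_a_internal[of j]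
  by (simp_all add: corner_strand_def[abs_def] src_opp_a)

lemma corner_Suc: "corner_strand j (Suc p) = cw_strand G (corner_strand j p)"
  by (simp add: corner_strand_def)

lemma corner_back: "k < ma (j + 3) \<Longrightarrow> corner_strand j k = (opp G (a (j + 3)), k)"
  using cw_funpow_within[of k "opp G (a (j + 3))"] by (simp add: corner_strand_def mult_opp_a)

lemma corner_forward_start: "corner_strand j (ma (j + 3)) = (a j, 0)"
  using cw_funpow_mult[OF opp_a_darts, of "j + 3"] rot_opp_a[of "j + 3"]
  by (simp add: corner_strand_def mult_opp_a)

lemma corner_add: "corner_strand j (p + q) = (cw_strand G ^^ q) (corner_strand j p)"
  unfolding corner_strand_def add.commute[of p q] funpow_add by simp

lemma corner_forward: "k < ma j \<Longrightarrow> corner_strand j (ma (j + 3) + k) = (a j, k)"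
  unfolding corner_add corner_forward_start by (rule cw_funpow_within)

lemma corner_outer_start: "corner_strand j (ma (j + 3) + ma j) = (rot G (a j), 0)"
  unfolding corner_add corner_forward_start by (rule cw_funpow_mult[OF a_darts])

lemma corner_mem:
  assumes "p < r"
  shows "fst (corner_strand j p) \<in> darts G" "src G (fst (corner_strand j p)) = src G (a j)"
    "snd (corner_strand j p) < mult G (fst (corner_strand j p))"
proof -
  have "corner_strand j p \<in> {(x, k). x \<in> darts G \<and> src G x = src G (a j) \<and> k < mult G x}"
    unfolding corner(1) using assms by auto
  then show "fst (corner_strand j p) \<in> darts G" "src G (fst (corner_strand j p)) = src G (a j)"
    "snd (corner_strand j p) < mult G (fst (corner_strand j p))"
    by (auto simp: case_prod_beta)
qed

text \<open>Ensures that the subtraction defining \<open>na\<close> is not truncated. If the two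
  hourglasses of the square overfilled the corner, position \<open>r\<close>, which closes the cycle
  at strand 0 of \<open>opp G (a (j + 3))\<close>, would have to be a different strand of one of
  them.\<close>

lemma corner_degree: "ma (j + 3) + ma j + na j = r"
proof -
  have "(a j, ma j - 1) \<in> corner_strand j ` {..<r}"
    unfolding corner(1)[symmetric] using a_darts ma_pos[of j] by auto
  then obtain p where p: "p < r" "corner_strand j p = (a j, ma j - 1)" by auto
  have "ma (j + 3) + (ma j - 1) < r"
  proof (rule ccontr)
    assume le: "\<not> ma (j + 3) + (ma j - 1) < r"
    show False
    proof (cases "r < ma (j + 3)")
      case True
      then show False using corner_back[of r j] corner(3)[of j] p by simp
    next
      case False
      then have "r - ma (j + 3) < ma j" "ma (j + 3) + (r - ma (j + 3)) = r"
        using le ma_pos[of j] by linarith+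
      then show False
        using corner_forward[of "r - ma (j + 3)" j] corner(3)[of j] a_neq_opp_a[of j "j + 3"] by simp
    qed
  qed
  then show ?thesis using ma_pos[of j] by (simp add: na_def)
qed

text \<open>The strands of the two arcs of the square at the corner already occupy the positions
  before \<open>ma (j + 3) + ma j\<close>, and no strand has two positions below
  \<open>r\<close>.\<close>

lemma outer_not_sq:
  assumes "t < na j"
  shows "fst (outer j t) \<notin> sq"
proof
  assume "fst (outer j t) \<in> sq"
  let ?p = "ma (j + 3) + ma j + t"
  have p: "?p < r" using assms corner_degree[of j] by simp
  note mem = corner_mem[OF p, of j]
  obtain d k where dk: "corner_strand j ?p = (d, k)" by (cases "corner_strand j ?p")
  have "d = a j \<or> d = opp G (a (j + 3))"
    using sq_at_corner[of d j] \<open>fst (outer j t) \<in> sq\<close> mem(2) dk by (simp add: outer_def)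
  then obtain q where "q < ma (j + 3) + ma j" "corner_strand j q = (d, k)"
  proof
    assume "d = a j"
    then show thesis using that[of "ma (j + 3) + k"] corner_forward[of k j] mem(3) dk by simp
  next
    assume "d = opp G (a (j + 3))"
    then show thesis using that[of k] corner_back[of k j] mem(3) dk mult_opp_a by simp
  qed
  then have "q = ?p" using corner(2)[of j] p dk by (auto simp: inj_on_def)
  then show False using \<open>q < _\<close> by simp
qed

lemma outer_mem:
  assumes "t < na j"
  shows "fst (outer j t) \<in> darts G" "src G (fst (outer j t)) = src G (a j)"
    "snd (outer j t) < mult G (fst (outer j t))" "outer j t \<in> crossing_strands G sq"
proof -
  have p: "ma (j + 3) + ma j + t < r" using assms corner_degree[of j] by simp
  show 1: "fst (outer j t) \<in> darts G" "src G (fst (outer j t)) = src G (a j)"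
    "snd (outer j t) < mult G (fst (outer j t))"
    using corner_mem[OF p] by (simp_all add: outer_def)
  then show "outer j t \<in> crossing_strands G sq"
    using outer_not_sq[OF assms] src_sq
    by (auto simp: crossing_strands_def crossing_darts_def case_prod_beta)
qed

lemma crossing_strands_eq: "crossing_strands G sq = {outer j t |j t. t < na j}"
proof (intro equalityI subsetI)
  fix s assume "s \<in> crossing_strands G sq"
  then obtain d k j where s: "s = (d, k)" "d \<in> darts G" "src G d = src G (a j)" "d \<notin> sq"
    "k < mult G d"
    using src_sq by (auto simp: crossing_strands_def crossing_darts_def)
  then have "s \<in> corner_strand j ` {..<r}" unfolding corner(1)[symmetric] by auto
  then obtain p where p: "p < r" "s = corner_strand j p" by auto
  have "\<not> p < ma (j + 3)" using corner_back[of p j] p s by (auto simp: sq_def)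
  moreover have "\<not> (ma (j + 3) \<le> p \<and> p < ma (j + 3) + ma j)"
    using corner_forward[of "p - ma (j + 3)" j] p s by (auto simp: sq_def)
  ultimately have "ma (j + 3) + ma j \<le> p" by simp
  then have "s = outer j (p - (ma (j + 3) + ma j))" "p - (ma (j + 3) + ma j) < na j"
    using p corner_degree[of j] by (simp_all add: outer_def)
  then show "s \<in> {outer j t |j t. t < na j}" by blast
qed (use outer_mem in auto)

lemma outer_eq:
  assumes "s < na i" "t < na j"
  shows "outer i s = outer j t \<longleftrightarrow> i = j \<and> s = t"
proof
  assume eq: "outer i s = outer j t"
  then have ij: "i = j" using outer_mem(2)[OF assms(1)] outer_mem(2)[OF assms(2)] src_a_eq by metis
  moreover have "s = t"
  proof -
    have "ma (j + 3) + ma j + s = ma (j + 3) + ma j + t"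
      using eq assms ij corner_degree[of j] unfolding outer_def
      by (intro inj_onD[OF corner(2)]) simp_all
    then show ?thesis by simp
  qed
  ultimately show "i = j \<and> s = t" by simp
qed simp

lemma outer_step:
  assumes "t < na j"
  shows "cw_strand G (outer j t) = (if Suc t < na j then outer j (Suc t) else (opp G (a (j + 3)), 0))"
proof -
  have "ma (j + 3) + ma j + Suc t = r" if "\<not> Suc t < na j" using assms that corner_degree[of j] by simp
  then show ?thesis using corner(3)[of j] by (auto simp: outer_def corner_Suc[symmetric])
qed

lemma outer_start: "(rot G (a j), 0) = (if na j = 0 then (opp G (a (j + 3)), 0) else outer j 0)"
  using corner_outer_start[of j] corner(3)[of j] corner_degree[of j] by (auto simp: outer_def)

lemma opp_sq: "d \<in> sq \<Longrightarrow> opp G d \<in> sq"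
  using opp_opp[OF a_darts] by (auto simp: sq_def)

section \<open>The contour of the square and the order of its boundary vertices\<close>

lemma contracted_rot_permutation: "permutation (contracted_rot G sq)"
proof -
  let ?o = "\<lambda>d. if d \<in> sq then opp G d else d"
  have inv: "?o (?o d) = d" for d
    using opp_sq opp_opp sq_darts by auto
  have "?o permutes darts G"
  proof (rule bij_imp_permutes)
    have "?o ` darts G \<subseteq> darts G" using opp_darts by auto
    moreover have "d \<in> ?o ` darts G" if "d \<in> darts G" for d
      using image_eqI[of d ?o "?o d" "darts G"] inv[of d] that opp_darts by auto
    moreover have "inj_on ?o (darts G)" by (rule inj_on_inverseI[of _ ?o]) (rule inv)
    ultimately show "bij_betw ?o (darts G) (darts G)" unfolding bij_betw_def by blast
  qed (use sq_darts in auto)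
  from permutes_compose[OF this rot_permutes] have "rot G \<circ> ?o permutes darts G" .
  moreover have "contracted_rot G sq = rot G \<circ> ?o" by (auto simp: contracted_rot_def)
  ultimately show ?thesis using permutation_permutes finite_arcs by metis
qed

lemma set_contour: "set (contour G sq c) = orbit (contracted_rot G sq) c"
proof -
  have "c \<in> orbit (contracted_rot G sq) c"
    by (rule permutation_self_in_orbit[OF contracted_rot_permutation])
  from orbit_enumeration(1)[OF this] show ?thesis
    unfolding contour_def by (simp only: set_map set_upt lessThan_atLeast0)
qed

text \<open>After \<open>opp G (a j)\<close> the contour follows the outer strands of corner
  \<open>j\<close>. The bound is weak on purpose: position \<open>r\<close> is the arc
  \<open>opp G (a (j + 3))\<close>, which leads on to the preceding corner.\<close>

lemma contour_corner:
  assumes start: "opp G (a j) \<in> orbit (contracted_rot G sq) c"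
    and "ma (j + 3) + ma j + t \<le> r"
  shows "fst (corner_strand j (ma (j + 3) + ma j + t)) \<in> orbit (contracted_rot G sq) c"
  using assms(2)
proof (induction t)
  case 0
  have "contracted_rot G sq (opp G (a j)) = rot G (a j)"
    using opp_opp[OF a_darts] by (auto simp: contracted_rot_def sq_def)
  then show ?case using orbit.step[OF start] corner_outer_start[of j] by simp
next
  case (Suc t)
  let ?s = "outer j t"
  have t: "t < na j" using Suc.prems corner_degree[of j] by simp
  have IH: "fst ?s \<in> orbit (contracted_rot G sq) c" using Suc by (simp add: outer_def)
  have "contracted_rot G sq (fst ?s) = rot G (fst ?s)"
    using outer_not_sq[OF t] by (simp add: contracted_rot_def)
  then have "rot G (fst ?s) \<in> orbit (contracted_rot G sq) c" using orbit.step[OF IH] by simp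
  moreover have "corner_strand j (ma (j + 3) + ma j + Suc t) = cw_strand G ?s"
    by (simp add: outer_def corner_Suc)
  \<comment> \<open>The contour consists of arcs, not strands: a step to another strand of the same
    hourglass does not advance it.\<close>
  moreover have "fst (cw_strand G ?s) \<in> {fst ?s, rot G (fst ?s)}" by (cases ?s) auto
  ultimately show ?case using IH by auto
qed

text \<open>Passing from each corner to the preceding one, the contour reaches all four, wherever it
  starts.\<close>

lemma outer_in_contour:
  assumes "t < na j"
  shows "fst (outer j t) \<in> orbit (contracted_rot G sq) (opp G (a i))"
proof -
  let ?O = "orbit (contracted_rot G sq) (opp G (a i))"
  have previous: "opp G (a (k + 3)) \<in> ?O" if "opp G (a k) \<in> ?O" for k
    using contour_corner[OF that, of "na k"] corner_degree[of k] corner(3)[of k] by simp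
  have "opp G (a i) \<in> ?O" by (rule permutation_self_in_orbit[OF contracted_rot_permutation])
  then have "opp G (a k) \<in> ?O" for k
    using previous[of i] previous[of "i + 3"] previous[of "i + 2"] exhaust_index4[of k i] by auto
  then show ?thesis using contour_corner[of j] assms corner_degree[of j] by (simp add: outer_def)
qed

lemma contour_crossing:
  assumes "d \<in> orbit (contracted_rot G sq) (opp G (a i))" "d \<notin> sq"
  shows "d \<in> crossing_darts G sq"
proof -
  have "d \<in> darts G \<and> src G d \<in> src G ` sq"
    using assms(1)
  proof induction
    case base
    then show ?case
      using opp_opp[OF a_darts] a_darts src_rot rot_darts
      by (auto simp: contracted_rot_def sq_def)
  next
    case (step d)
    have "opp G d \<in> darts G \<and> src G (opp G d) \<in> src G ` sq" if "d \<in> sq"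
      using opp_sq[OF that] sq_darts by blast
    then show ?case
      using step src_rot rot_darts by (auto simp: contracted_rot_def)
  qed
  then show ?thesis using assms(2) by (simp add: crossing_darts_def)
qed

abbreviation sq_graph :: "4 \<Rightarrow> (('v, 'a) cut_vertex, 'a cut_dart) hourglass_graph" where
  "sq_graph i \<equiv> cut_graph G sq (opp G (a i))"

lemma bdry_sq_graph:
  "set (bdry (sq_graph i)) = {case_prod New (outer j t) |j t. t < na j}"
proof -
  have "set (bdry (sq_graph i)) =
    {New d k |d k. d \<in> orbit (contracted_rot G sq) (opp G (a i)) \<and> d \<notin> sq \<and> k < mult G d}"
    by (auto simp: cut_graph_def set_contour)
  also have "\<dots> = case_prod New ` crossing_strands G sq"
  proof -
    have "d \<in> orbit (contracted_rot G sq) (opp G (a i))" if dk: "(d, k) \<in> crossing_strands G sq" for d k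
    proof -
      obtain j t where "t < na j" "(d, k) = outer j t" using dk crossing_strands_eq by auto
      then show ?thesis using outer_in_contour[of t j i] by (metis fst_conv)
    qed
    note in_orbit = this
    have "d \<in> orbit (contracted_rot G sq) (opp G (a i)) \<and> d \<notin> sq \<and> k < mult G d \<longleftrightarrow>
        (d, k) \<in> crossing_strands G sq" (is "?l \<longleftrightarrow> ?r") for d k
    proof
      assume ?l
      then show ?r using contour_crossing[of d i] by (simp add: crossing_strands_def)
    next
      assume ?r
      then have "d \<notin> sq" "k < mult G d" by (simp_all add: crossing_strands_def crossing_darts_def)
      then show ?l using in_orbit[OF \<open>?r\<close>] by simp
    qed
    then show ?thesis by auto
  qed
  finally show ?thesis unfolding crossing_strands_eq image_Collect2 .
qed

text \<open>Each crossing strand receives its own two arcs and boundary vertex. A clockwise step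
  between strands of one hourglass becomes a step between two consecutive simple edges, so
  \<open>cw_strand\<close> of the ambient graph governs the rotation at the corners of the cut
  graph.\<close>

lemma framed_square_sq_graph:
  "framed_square r (sq_graph i) ma na (\<lambda>j. Old (src G (a j))) (\<lambda>j t. case_prod New (outer j t))
    (\<lambda>j. Inside (a j)) (\<lambda>j. Inside (opp G (a j)))
    (\<lambda>j t. case_prod Outward (outer j t)) (\<lambda>j t. case_prod Inward (outer j t))"
proof -
  have arcs: "darts (sq_graph i) = Inside ` sq \<union> case_prod Outward ` crossing_strands G sq
      \<union> case_prod Inward ` crossing_strands G sq"
    by (auto simp: cut_graph_def cut_base_def)
  have darts: "darts (sq_graph i) = range (\<lambda>j. Inside (a j)) \<union> range (\<lambda>j. Inside (opp G (a j)))
      \<union> {case_prod Outward (outer j t) |j t. t < na j}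
      \<union> {case_prod Inward (outer j t) |j t. t < na j}"
    unfolding arcs crossing_strands_eq image_Collect2 by (simp add: sq_def image_Un image_image)
  have cut_darts: "arcs (cut_base G sq) = darts (sq_graph i)" by (simp add: cut_graph_def)
  have in_sq: "a j \<in> sq" "opp G (a j) \<in> sq" for j by (auto simp: sq_def)
  have mem: "Inside (a j) \<in> darts (sq_graph i)" "Inside (opp G (a j)) \<in> darts (sq_graph i)"
    "t < na j \<Longrightarrow> case_prod Outward (outer j t) \<in> darts (sq_graph i)"
    "t < na j \<Longrightarrow> case_prod Inward (outer j t) \<in> darts (sq_graph i)" for j t
    unfolding darts by auto
  have opp_sel: "opp (sq_graph i) = (\<lambda>e. if e \<notin> darts (sq_graph i) then e else
      case e of Inside a \<Rightarrow> Inside (opp G a) | Outward d k \<Rightarrow> Inward d k | Inward d k \<Rightarrow> Outward d k)"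
    unfolding cut_darts[symmetric] by (simp add: cut_graph_def)
  have rot_sel: "rot (sq_graph i) = (\<lambda>e. if e \<notin> darts (sq_graph i) then e else
      case e of Inside a \<Rightarrow> cut_first sq (rot G a)
        | Outward d k \<Rightarrow> (if Suc k < mult G d then Outward d (Suc k) else cut_first sq (rot G d))
        | Inward d k \<Rightarrow> Inward d k)"
    unfolding cut_darts[symmetric] by (simp add: cut_graph_def)
  show ?thesis
  proof
    fix j t
    show "0 < ma j" by (rule ma_pos)
    show "ma (j + 3) + ma j + na j = r" by (rule corner_degree)
    show "verts (base (sq_graph i)) =
        range (\<lambda>j. Old (src G (a j))) \<union> {case_prod New (outer j t) |j t. t < na j}"
    proof -
      have "verts (base (sq_graph i)) = Old ` src G ` sq \<union> case_prod New ` crossing_strands G sq"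
        by (auto simp: cut_graph_def cut_base_def)
      then show ?thesis unfolding src_sq crossing_strands_eq image_Collect2 by (simp add: image_image)
    qed
    show "darts (sq_graph i) = range (\<lambda>j. Inside (a j)) \<union> range (\<lambda>j. Inside (opp G (a j)))
      \<union> {case_prod Outward (outer j t) |j t. t < na j}
      \<union> {case_prod Inward (outer j t) |j t. t < na j}" by (rule darts)
    show "rot (sq_graph i) (Inside (opp G (a (j + 3)))) = Inside (a j)"
      using mem(2)[of "j + 3"] in_sq[of j] rot_opp_a[of "j + 3"] by (simp add: rot_sel cut_first_def)
    show "rot (sq_graph i) (Inside (a j)) =
        (if na j = 0 then Inside (opp G (a (j + 3))) else case_prod Outward (outer j 0))"
      using mem(1)[of j] in_sq(2)[of "j + 3"] outer_start[of j] outer_not_sq[of 0 j]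
      by (cases "outer j 0") (auto simp: rot_sel cut_first_def split: if_splits)
    show "white (sq_graph i) (Old (src G (a (j + 1)))) = (\<not> white (sq_graph i) (Old (src G (a j))))"
      using bipartite[OF a_darts[of j]] tgt_a[of j] by (auto simp: cut_graph_def)
    show "set (bdry (sq_graph i)) = {case_prod New (outer j t) |j t. t < na j}"
      by (rule bdry_sq_graph)
    show "opp (sq_graph i) d = d" "rot (sq_graph i) d = d" if "d \<notin> darts (sq_graph i)" for d
      using that by (simp_all add: opp_sel rot_sel)
    show "opp (sq_graph i) (Inside (a j)) = Inside (opp G (a j))"
      "opp (sq_graph i) (Inside (opp G (a j))) = Inside (a j)"
      using mem(1,2)[of j] opp_opp[OF a_darts] by (simp_all add: opp_sel)
    show "src (sq_graph i) (Inside (a j)) = Old (src G (a j))"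
      "tgt (sq_graph i) (Inside (a j)) = Old (src G (a (j + 1)))"
      "src (sq_graph i) (Inside (opp G (a j))) = Old (src G (a (j + 1)))"
      "tgt (sq_graph i) (Inside (opp G (a j))) = Old (src G (a j))"
      by (simp_all add: cut_graph_def cut_base_def tgt_a src_opp_a tgt_opp[OF a_darts])
    show "mult (sq_graph i) (Inside (a j)) = ma j"
      "mult (sq_graph i) (Inside (opp G (a j))) = ma j"
      by (simp_all add: cut_graph_def mult_opp_a)
    show "Old (src G (a j)) = Old (src G (a j')) \<longleftrightarrow> j = j'" for j'
      by (simp add: src_a_eq)
    show "Inside (a j) \<noteq> Inside (opp G (a j'))" for j' by (simp add: a_neq_opp_a)
    assume t: "t < na j"
    obtain d k where dk: "outer j t = (d, k)" by (cases "outer j t")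
    note mem' = mem(3,4)[OF t, unfolded dk, simplified] and out = outer_mem[OF t, unfolded dk]
    show "src (sq_graph i) (case_prod Outward (outer j t)) = Old (src G (a j))"
      "tgt (sq_graph i) (case_prod Outward (outer j t)) = case_prod New (outer j t)"
      "src (sq_graph i) (case_prod Inward (outer j t)) = case_prod New (outer j t)"
      "tgt (sq_graph i) (case_prod Inward (outer j t)) = Old (src G (a j))"
      using out by (simp_all add: dk cut_graph_def cut_base_def)
    show "opp (sq_graph i) (case_prod Outward (outer j t)) = case_prod Inward (outer j t)"
      "opp (sq_graph i) (case_prod Inward (outer j t)) = case_prod Outward (outer j t)"
      "rot (sq_graph i) (case_prod Inward (outer j t)) = case_prod Inward (outer j t)"
      using mem' by (simp_all add: dk opp_sel rot_sel)
    show "mult (sq_graph i) (case_prod Outward (outer j t)) = 1"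
      "mult (sq_graph i) (case_prod Inward (outer j t)) = 1"
      by (simp_all add: dk cut_graph_def)
    show "Old (src G (a j')) \<noteq> case_prod New (outer j t)"
      "Inside (a j') \<noteq> case_prod Outward (outer j t)"
      "Inside (opp G (a j')) \<noteq> case_prod Outward (outer j t)" for j'
      by (simp_all add: dk)
    show "case_prod New (outer j' t') = case_prod New (outer j t) \<longleftrightarrow> j' = j \<and> t' = t"
      if "t' < na j'" for j' t'
      using outer_eq[OF that t] by (cases "outer j' t'") (simp add: dk)
    show "rot (sq_graph i) (case_prod Outward (outer j t)) =
        (if Suc t < na j then case_prod Outward (outer j (Suc t)) else Inside (opp G (a (j + 3))))"
    proof -
      have step: "(if Suc k < mult G d then (d, Suc k) else (rot G d, 0)) =
          (if Suc t < na j then outer j (Suc t) else (opp G (a (j + 3)), 0))"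
        using outer_step[OF t] by (simp add: dk)
      have d: "d \<notin> sq" using outer_not_sq[OF t] dk by simp
      have rot: "rot (sq_graph i) (case_prod Outward (outer j t)) =
          (if Suc k < mult G d then Outward d (Suc k) else cut_first sq (rot G d))"
        using mem' by (simp add: dk rot_sel)
      show ?thesis
      proof (cases "Suc t < na j")
        case True
        then show ?thesis
          using step outer_not_sq[OF True] unfolding rot
          by (cases "outer j (Suc t)") (auto simp: cut_first_def split: if_splits)
      next
        case False
        then show ?thesis
          using step in_sq(2)[of "j + 3"] d unfolding rot
          by (auto simp: cut_first_def split: if_splits)
      qed
    qed
  qed
qed

end

text \<open>The 4-cycle and the orbit describing the face have the same arcs, but their orders have
  to be matched. The arcs of the cycle have distinct sources, so the successor of an arc in the
  orbit is the unique one that leaves its head, and that is its successor in the cycle.\<close>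

lemma square_face_square_in_graph:
  fixes G :: "('v, 'a) hourglass_graph"
  assumes "hourglass_plabic_graph r G" "square_face G F"
  obtains a where "square_in_graph r G a" "F = range a"
proof -
  interpret hourglass_plabic_graph r G by (fact assms(1))
  let ?f = "\<lambda>d. rot G (opp G d)"
  obtain a0 where a0: "a0 \<in> darts G" "F = orbit ?f a0" and internal: "\<forall>d\<in>F. src G d \<notin> set (bdry G)"
    using assms(2) by (auto simp: square_face_def face_def)
  obtain p where p: "cycle p" "length p = 4" "set p = F"
    using assms(2) by (auto simp: square_face_def)
  obtain p0 p1 p2 p3 where pp: "p = [p0, p1, p2, p3]"
    using p(2) by (auto simp: numeral_eq_Suc length_Suc_conv)
  have darts: "set p \<subseteq> darts G" and
    ends: "tgt G p0 = src G p1" "tgt G p1 = src G p2" "tgt G p2 = src G p3" "tgt G p3 = src G p0"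
    and dist: "distinct [src G p0, src G p1, src G p2, src G p3]"
    using p(1) unfolding cycle_def awalk_def pp by auto
  define a :: "4 \<Rightarrow> 'a" where
    "a = (\<lambda>j. if j = 0 then p0 else if j = 1 then p1 else if j = 2 then p2 else p3)"
  have a_vals: "a 0 = p0" "a 1 = p1" "a 2 = p2" "a 3 = p3" by (simp_all add: a_def)
  have index: "j = 0 \<or> j = 1 \<or> j = 2 \<or> j = 3" for j :: 4
    using exhaust_index4[of j 0] by simp
  have F: "F = range a"
    using p(3) index unfolding pp by (auto simp: a_vals[symmetric] image_iff) metis
  have a_darts: "a j \<in> darts G" for j using darts F p(3) by auto
  have next_a: "tgt G (a j) = src G (a (j + 1))" for j
    using index[of j] ends by (auto simp: a_vals numeral_index4)
  have inj: "src G (a i) = src G (a j) \<longleftrightarrow> i = j" for i j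
    using index[of i] index[of j] dist by (auto simp: a_vals)
  have "?f (a j) = a (j + 1)" for j
  proof -
    have "a j \<in> F" using F by auto
    then have "?f (a j) \<in> range a" unfolding F[symmetric] a0(2) by (rule orbit.step)
    then obtain k where k: "?f (a j) = a k" by auto
    then have "src G (a k) = src G (a (j + 1))"
      using src_rot[OF opp_darts[OF a_darts]] src_opp[OF a_darts] next_a by metis
    then show ?thesis using inj k by simp
  qed
  then have "square_in_graph r G a"
    using a_darts next_a inj internal F by unfold_locales auto
  then show thesis using that F by blast
qed

theorem theorem5p5:
  fixes G :: "('v, 'a) hourglass_graph" and r :: nat and F :: "'a set"
  assumes "hourglass_plabic_graph r G"
    and "no_isolated_components G"
    and "square_face G F"
  shows "fully_reduced_face r G F \<longleftrightarrow> face_mult G F \<le> r"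
proof -
  obtain a where a: "square_in_graph r G a" "F = range a"
    using square_face_square_in_graph[OF assms(1,3)] .
  interpret square_in_graph r G a by (fact a(1))
  have "(SOME d. d \<in> F) \<in> F" by (rule someI[of _ "a 0"]) (simp add: a(2))
  \<comment> \<open>Whichever arc the choice operator picks, the framed square is available for its
    index \<open>i\<close>.\<close>
  then obtain i where "(SOME d. d \<in> F) = a i" using a(2) by auto
  then have graph: "face_graph G F = sq_graph i" by (simp add: face_graph_def sq_def a(2))
  have UNIV4: "(UNIV :: 4 set) = {0, 1, 2, 3}" using exhaust_index4[of _ 0] by auto
  have "face_mult G F = (\<Sum>j\<in>UNIV. ma j)"
    unfolding face_mult_def a(2) by (rule sum.reindex_cong[of a]) (auto simp: inj_def a_eq)
  also have "\<dots> = ma 0 + ma 1 + ma 2 + ma 3" unfolding UNIV4 by simp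
  finally have "face_mult G F = ma 0 + ma 1 + ma 2 + ma 3" .
  then show ?thesis
    using framed_square.fully_reduced_iff[OF framed_square_sq_graph[of i]] graph
    by (simp add: fully_reduced_face_def)
qed

end
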